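(* For every $\varepsilon_0>0$ there exists $C=C(\varepsilon_0)>0$ such that the following holds. Let $p=p(n)$ satisfy $\frac{C}{n}\le p\le 0.99$ and let $q=\frac{1}{1-p}$. Then with high probability (i.e. with probability tending to $1$ as $n\to\infty$) the largest induced matching in $G(n,p)$ has $(1\pm\varepsilon_0)\log_q(np)$ edges, i.e. its number of edges lies between $(1-\varepsilon_0)\log_q(np)$ and $(1+\varepsilon_0)\log_q(np)$.
   Context: $G(n,p)$ is the binomial random graph on vertex set $[n]=\{1,\dots,n\}$ in which each pair is an edge independently with probability $p$. An induced matching in a graph $H$ is a set of pairwise disjoint edges $M$ such that the subgraph of $H$ induced on the vertices covered by $M$ has exactly the edges of $M$. *)

theory Defs
  imports "HOL-Probability.Probability" "HOL-Probability.Product_PMF"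
begin

text \<open>
  A simple graph on a fixed vertex set is given by its edge set, a set of two-element vertex sets.
\<close>

definition vertex_pairs :: "nat \<Rightarrow> nat set set" where
  "vertex_pairs n = {e. e \<subseteq> {1..n} \<and> card e = 2}"

text \<open>
  The edge set of the binomial random graph on \<open>{1..n}\<close>. For \<open>p\<close> outside \<open>[0, 1]\<close>,
  \<^const>\<open>bernoulli_pmf\<close> clamps its parameter to that interval.
\<close>

definition gnp :: "nat \<Rightarrow> real \<Rightarrow> nat set set pmf" where
  "gnp n p = map_pmf (\<lambda>f. {e \<in> vertex_pairs n. f e})
               (Pi_pmf (vertex_pairs n) False (\<lambda>_. bernoulli_pmf p))"

definition induced_edges :: "'a set set \<Rightarrow> 'a set \<Rightarrow> 'a set set" where
  "induced_edges E U = {e \<in> E. e \<subseteq> U}"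

definition induced_matching :: "'a set set \<Rightarrow> 'a set set \<Rightarrow> bool" where
  "induced_matching E M \<longleftrightarrow>
     M \<subseteq> E \<and> pairwise disjnt M \<and> induced_edges E (\<Union>M) = M"

text \<open>
  The maximum is taken over a nonempty set (the empty matching is induced as soon as every edge is
  nonempty), which is finite if \<open>E\<close> is.
\<close>

definition induced_matching_number :: "'a set set \<Rightarrow> nat" where
  "induced_matching_number E = Max (card ` {M. induced_matching E M})"

lemma finite_vertex_pairs: "finite (vertex_pairs n)"
  by (rule finite_subset[of _ "Pow {1..n}"]) (auto simp: vertex_pairs_def)

lemma set_pmf_gnp_subset: "E \<in> set_pmf (gnp n p) \<Longrightarrow> E \<subseteq> vertex_pairs n"
  by (auto simp: gnp_def)

lemma induced_matching_number_attained:
  assumes "E \<subseteq> vertex_pairs n"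
  shows "\<exists>M. induced_matching E M \<and> card M = induced_matching_number E"
    and "induced_matching E M \<Longrightarrow> card M \<le> induced_matching_number E"
proof -
  have finE: "finite E"
    using assms finite_vertex_pairs finite_subset by blast
  have fin: "finite (card ` {M. induced_matching E M})"
    by (rule finite_imageI, rule finite_subset[of _ "Pow E"])
       (use finE in \<open>auto simp: induced_matching_def\<close>)
  have "induced_matching E {}"
    using assms by (auto simp: induced_matching_def induced_edges_def vertex_pairs_def)
  hence "card ` {M. induced_matching E M} \<noteq> {}"
    by auto
  from Max_in[OF fin this]
  show "\<exists>M. induced_matching E M \<and> card M = induced_matching_number E"
    unfolding induced_matching_number_def by auto
  show "card M \<le> induced_matching_number E" if "induced_matching E M"
    unfolding induced_matching_number_def using fin that by (auto intro: Max_ge)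
qed

end

theory Submission
  imports Defs "HOL-Probability.Hoeffding" "HOL-Real_Asymp.Real_Asymp"
begin

text \<open>
  Write \<open>m = n p\<close>. The upper bound is the first moment method, using that subsets of induced matchings
  are induced matchings.

  For the lower bound let \<open>k\<close> be slightly smaller than \<open>log\<^sub>q m\<close> and let \<open>X\<close> count the ordered placements of
  \<open>k\<close> edges that form an induced matching. Two placements that share \<open>w\<close> vertices and \<open>j\<close> edges are
  correlated by a factor of at most \<open>p\<^sup>-\<^sup>j q\<^bsup>w choose 2\<^esup>\<close>, and summing over the overlap patterns gives
  \<open>E X\<^sup>2 / (E X)\<^sup>2 \<le> exp (4 k\<^sup>2 \<eta> / n) + 2 \<beta>\<close> where \<open>\<eta>\<close> and \<open>\<beta>\<close> depend only on \<open>m\<close> and tend to \<open>0\<close>.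
  If \<open>n \<le> m\<^bsup>5/2\<^esup>\<close>, this ratio tends to \<open>1\<close> and the second moment method suffices. Otherwise it only shows
  that a matching of size \<open>k\<close> exists with probability at least \<open>exp (- 4 k\<^sup>2 \<eta> / n) / 2\<close>. But
  changing the edges at one vertex changes the induced matching number by at most \<open>1\<close>, so McDiarmid's
  inequality bounds the probability of deviating by \<open>\<delta> k\<close> from the mean by \<open>exp (- 2 \<delta>\<^sup>2 k\<^sup>2 / n)\<close>. As
  \<open>\<eta>\<close> is much smaller than \<open>\<delta>\<^sup>2\<close>, the mean is at least \<open>(1 - \<delta>) k\<close>, and the same inequality applied to the
  lower tail finishes the proof.
\<close>

section \<open>McDiarmid's inequality\<close>

lemma expectation_pair_pmf_finite:
  fixes f :: "'a \<times> 'b \<Rightarrow> real"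
  assumes "finite (set_pmf p)" "finite (set_pmf q)"
  shows "measure_pmf.expectation (pair_pmf p q) f =
           measure_pmf.expectation p (\<lambda>x. measure_pmf.expectation q (\<lambda>y. f (x, y)))"
proof -
  have "measure_pmf.expectation (pair_pmf p q) f =
      (\<Sum>x\<in>set_pmf p. pmf p x * measure_pmf.expectation (map_pmf (Pair x) q) f)"
    unfolding pair_pmf_def map_pmf_def[symmetric]
    by (subst pmf_expectation_bind[OF assms(1)]) (use assms in auto)
  also have "\<dots> = measure_pmf.expectation p (\<lambda>x. measure_pmf.expectation q (\<lambda>y. f (x, y)))"
    using assms by (subst integral_measure_pmf_real[of "set_pmf p"]) (auto simp: mult.commute)
  finally show ?thesis .
qed

text \<open>Bounded differences control only the oscillation of \<open>f\<close>, so the interval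
  for Hoeffding's lemma runs from the minimum to the maximum of \<open>f\<close> on the finite
  support; its length is at most \<open>c\<close>.\<close>

lemma Hoeffding_lemma_pmf:
  fixes f :: "'a \<Rightarrow> real"
  assumes fin: "finite (set_pmf q)" and "l > 0"
    and osc: "\<And>x y. x \<in> set_pmf q \<Longrightarrow> y \<in> set_pmf q \<Longrightarrow> f x - f y \<le> c"
  shows "measure_pmf.expectation q (\<lambda>x. exp (l * (f x - measure_pmf.expectation q f)))
           \<le> exp (l\<^sup>2 * c\<^sup>2 / 8)"
proof -
  let ?S = "f ` set_pmf q"
  define a b where "a = Min ?S" and "b = Max ?S"
  have S: "finite ?S" "?S \<noteq> {}"
    using fin by (auto simp: set_pmf_not_empty)
  obtain x y where xy: "x \<in> set_pmf q" "y \<in> set_pmf q" "a = f x" "b = f y"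
    using Max_in[OF S] Min_in[OF S] by (auto simp: a_def b_def)
  have "a \<le> f y"
    unfolding a_def using S(1) xy(2) by (intro Min_le) auto
  then have ab: "0 \<le> b - a" "b - a \<le> c"
    using osc[OF xy(2,1)] xy(3,4) by simp_all
  interpret X: interval_bounded_random_variable "measure_pmf q" f a b
    by unfold_locales (use S in \<open>auto simp: AE_measure_pmf_iff a_def b_def\<close>)
  let ?g = "\<lambda>x. exp (l * (f x - measure_pmf.expectation q f))"
  have "ennreal (measure_pmf.expectation q ?g) = nn_integral q ?g"
    by (rule nn_integral_eq_integral[symmetric])
       (use fin in \<open>auto intro: integrable_measure_pmf_finite\<close>)
  also have "\<dots> \<le> ennreal (exp (l\<^sup>2 * (b - a)\<^sup>2 / 8))"
    by (rule X.Hoeffdings_lemma_nn_integral) fact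
  finally have "measure_pmf.expectation q ?g \<le> exp (l\<^sup>2 * (b - a)\<^sup>2 / 8)"
    by simp
  also have "\<dots> \<le> exp (l\<^sup>2 * c\<^sup>2 / 8)"
    using ab by (auto intro!: mult_left_mono power_mono)
  finally show ?thesis .
qed

lemma finite_set_Pi_pmf:
  assumes "finite A" "\<And>x. x \<in> A \<Longrightarrow> finite (set_pmf (p x))"
  shows "finite (set_pmf (Pi_pmf A d p))"
  using assms by (auto simp: set_Pi_pmf)

text \<open>
  The induction splits off one block: conditionally on the others, \<open>f\<close> oscillates by at most \<open>c\<close>, so Hoeffding's lemma applies, and
  averaging over that block preserves the Lipschitz condition.
\<close>
lemma mcdiarmid_mgf:
  fixes f :: "('a \<Rightarrow> 'b) \<Rightarrow> real" and d :: 'b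
  assumes "finite I" "\<And>i. i \<in> I \<Longrightarrow> finite (B i)" "disjoint_family_on B I"
    and fin: "\<And>x. finite (set_pmf (p x))" and "l > 0"
    and "\<And>i g h. i \<in> I \<Longrightarrow> (\<And>x. x \<notin> B i \<Longrightarrow> g x = h x) \<Longrightarrow> f g - f h \<le> c"
  defines "P \<equiv> Pi_pmf (\<Union>i\<in>I. B i) d p"
  shows "measure_pmf.expectation P (\<lambda>g. exp (l * (f g - measure_pmf.expectation P f)))
           \<le> exp (l\<^sup>2 * c\<^sup>2 * card I / 8)"
  using assms(1,2,3,6) unfolding P_def
proof (induction I arbitrary: f rule: finite_induct)
  case empty
  then show ?case by simp
next
  case (insert j I)
  let ?A = "\<Union>i\<in>I. B i"
  let ?p = "Pi_pmf ?A d p" and ?q = "Pi_pmf (B j) d p"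
  let ?E = "measure_pmf.expectation"
  define m where "m = (\<lambda>(g :: 'a \<Rightarrow> 'b, h) x. if x \<in> ?A then g x else h x)"
  have fin': "finite (set_pmf ?p)" "finite (set_pmf ?q)"
    using insert.prems insert.hyps fin by (auto intro!: finite_set_Pi_pmf)
  have disj: "?A \<inter> B j = {}"
    using insert.prems(2) insert.hyps(2) by (fastforce simp: disjoint_family_on_def)
  have un: "Pi_pmf (\<Union>i\<in>insert j I. B i) d p = map_pmf m (pair_pmf ?p ?q)"
    using Pi_pmf_union[of ?A "B j" d p] disj insert.prems insert.hyps
    by (simp add: m_def Un_commute)
  have E: "?E (Pi_pmf (\<Union>i\<in>insert j I. B i) d p) u = ?E ?p (\<lambda>g. ?E ?q (\<lambda>h. u (m (g, h))))"
    for u :: "_ \<Rightarrow> real"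
    unfolding un integral_map_pmf by (rule expectation_pair_pmf_finite[OF fin'])
  define F where "F = (\<lambda>g. ?E ?q (\<lambda>h. f (m (g, h))))"
  have EF: "?E (Pi_pmf (\<Union>i\<in>insert j I. B i) d p) f = ?E ?p F"
    unfolding E F_def ..
  have int: "integrable (measure_pmf ?q) u" "integrable (measure_pmf ?p) u" for u :: "_ \<Rightarrow> real"
    using fin' by (auto intro: integrable_measure_pmf_finite)
  have "F g - F h \<le> c" if "i \<in> I" "\<And>x. x \<notin> B i \<Longrightarrow> g x = h x" for i g h
  proof -
    have "F g - F h = ?E ?q (\<lambda>y. f (m (g, y)) - f (m (h, y)))"
      unfolding F_def by (rule Bochner_Integration.integral_diff[symmetric]) (rule int)+
    also have "\<dots> \<le> ?E ?q (\<lambda>_. c)"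
      by (intro integral_mono int insert.prems(3)[of i]) (use that in \<open>auto simp: m_def\<close>)
    finally show ?thesis by simp
  qed
  then have IH: "?E ?p (\<lambda>g. exp (l * (F g - ?E ?p F))) \<le> exp (l\<^sup>2 * c\<^sup>2 * card I / 8)"
    using insert.prems by (intro insert.IH) (auto simp: disjoint_family_on_def)
  have "?E ?q (\<lambda>h. exp (l * (f (m (g, h)) - ?E ?p F)))
          \<le> exp (l * (F g - ?E ?p F)) * exp (l\<^sup>2 * c\<^sup>2 / 8)" for g
  proof -
    have "exp (l * (f (m (g, h)) - ?E ?p F)) =
        exp (l * (F g - ?E ?p F)) * exp (l * (f (m (g, h)) - F g))" for h
      by (simp add: exp_add[symmetric] algebra_simps)
    then have "?E ?q (\<lambda>h. exp (l * (f (m (g, h)) - ?E ?p F))) =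
        exp (l * (F g - ?E ?p F)) * ?E ?q (\<lambda>h. exp (l * (f (m (g, h)) - F g)))"
      by simp
    also have "\<dots> \<le> exp (l * (F g - ?E ?p F)) * exp (l\<^sup>2 * c\<^sup>2 / 8)"
    proof (rule mult_left_mono)
      \<comment> \<open>Functions in the support of \<open>?q\<close> take the default value
        \<open>d\<close> off \<open>B j\<close>, so two functions merged with the same
        \<open>g\<close> can differ only on the block \<open>B j\<close>.\<close>
      have eq: "m (g, x) z = m (g, y) z"
        if "x \<in> set_pmf ?q" "y \<in> set_pmf ?q" "z \<notin> B j" for x y z
      proof -
        have "x z = d" "y z = d"
          using that set_Pi_pmf_subset[of "B j" d p] insert.prems(1)[of j] by auto
        then show ?thesis by (simp add: m_def)
      qed
      show "?E ?q (\<lambda>h. exp (l * (f (m (g, h)) - F g))) \<le> exp (l\<^sup>2 * c\<^sup>2 / 8)"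
        unfolding F_def
        by (rule Hoeffding_lemma_pmf[OF fin'(2) \<open>l > 0\<close>], rule insert.prems(3)[of j], simp)
          (rule eq)
    qed auto
    finally show ?thesis .
  qed
  then have "?E ?p (\<lambda>g. ?E ?q (\<lambda>h. exp (l * (f (m (g, h)) - ?E ?p F))))
      \<le> ?E ?p (\<lambda>g. exp (l * (F g - ?E ?p F)) * exp (l\<^sup>2 * c\<^sup>2 / 8))"
    by (intro integral_mono int)
  also have "\<dots> \<le> exp (l\<^sup>2 * c\<^sup>2 * card I / 8) * exp (l\<^sup>2 * c\<^sup>2 / 8)"
    using IH by simp
  also have "\<dots> = exp (l\<^sup>2 * c\<^sup>2 * card (insert j I) / 8)"
    using insert.hyps by (simp add: exp_add[symmetric] field_simps)
  finally show ?case
    unfolding EF unfolding E .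
qed

lemma mcdiarmid:
  fixes f :: "('a \<Rightarrow> 'b) \<Rightarrow> real" and c t :: real and d :: 'b
  assumes I: "finite I" "I \<noteq> {}" and B: "\<And>i. i \<in> I \<Longrightarrow> finite (B i)" "disjoint_family_on B I"
    and fin: "\<And>x. finite (set_pmf (p x))" and "c > 0" and "t > 0"
    and lip: "\<And>i g h. i \<in> I \<Longrightarrow> (\<And>x. x \<notin> B i \<Longrightarrow> g x = h x) \<Longrightarrow> f g - f h \<le> c"
  defines "P \<equiv> Pi_pmf (\<Union>i\<in>I. B i) d p"
  shows "measure_pmf.prob P {g. f g \<ge> measure_pmf.expectation P f + t}
           \<le> exp (- 2 * t\<^sup>2 / (card I * c\<^sup>2))"
proof -
  let ?\<mu> = "measure_pmf.expectation P f"
  \<comment> \<open>This \<open>l\<close> minimises the Chernoff exponent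
    \<open>- l * t + l\<^sup>2 * c\<^sup>2 * card I / 8\<close>.\<close>
  define l where "l = 4 * t / (card I * c\<^sup>2)"
  have "card I > 0" using I by (simp add: card_gt_0_iff)
  then have "l > 0" using \<open>c > 0\<close> \<open>t > 0\<close> by (simp add: l_def)
  have P: "finite (set_pmf P)"
    unfolding P_def using I B fin by (intro finite_set_Pi_pmf) auto
  have mgf: "measure_pmf.expectation P (\<lambda>g. exp (l * (f g - ?\<mu>))) \<le> exp (l\<^sup>2 * c\<^sup>2 * card I / 8)"
    unfolding P_def by (rule mcdiarmid_mgf[OF I(1) B fin \<open>l > 0\<close> lip])
  have "measure_pmf.prob P {g. f g \<ge> ?\<mu> + t} = measure_pmf.expectation P (indicator {g. f g \<ge> ?\<mu> + t})"
    by simp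
  also have "\<dots> \<le> measure_pmf.expectation P (\<lambda>g. exp (- l * t) * exp (l * (f g - ?\<mu>)))"
  proof (intro integral_mono integrable_measure_pmf_finite P)
    fix g
    show "indicator {g. f g \<ge> ?\<mu> + t} g \<le> exp (- l * t) * exp (l * (f g - ?\<mu>))"
    proof (cases "f g \<ge> ?\<mu> + t")
      case True
      have "0 \<le> l * (f g - ?\<mu> - t)"
        using \<open>l > 0\<close> True by (intro mult_nonneg_nonneg) auto
      then show ?thesis
        using True by (simp add: exp_add[symmetric] algebra_simps)
    qed simp
  qed
  also have "\<dots> \<le> exp (- l * t) * exp (l\<^sup>2 * c\<^sup>2 * card I / 8)"
    using mgf by (subst Bochner_Integration.integral_mult_right_zero) (rule mult_left_mono, auto)
  also have "\<dots> = exp (- 2 * t\<^sup>2 / (card I * c\<^sup>2))"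
    using \<open>card I > 0\<close> \<open>c > 0\<close>
    by (simp add: exp_add[symmetric] l_def field_simps power2_eq_square)
  finally show ?thesis .
qed

section \<open>Concentration of the induced matching number\<close>

lemma mem_vertex_pairs: "e \<in> vertex_pairs n \<longleftrightarrow> e \<subseteq> {1..n} \<and> card e = 2"
  by (simp add: vertex_pairs_def)

lemma card_vertex_pairs: "card (vertex_pairs n) = n choose 2"
  using n_subsets[of "{1..n}" 2] by (simp add: vertex_pairs_def)

text \<open>The event is a box in the product space: coordinates in \<open>T\<close> are true, those
  in \<open>S - T\<close> false, and all others are free.\<close>

lemma prob_gnp_Int_eq:
  assumes p: "0 \<le> p" "p \<le> 1" and "S \<subseteq> vertex_pairs n" "T \<subseteq> S"
  shows "measure_pmf.prob (gnp n p) {E. E \<inter> S = T} = p ^ card T * (1 - p) ^ card (S - T)"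
proof -
  let ?V = "vertex_pairs n"
  define B where "B e = (if e \<in> T then {True} else if e \<in> S then {False} else UNIV)" for e
  have fin: "finite ?V" "finite S" "finite T"
    using finite_subset[OF assms(3) finite_vertex_pairs] finite_subset[OF assms(4)]
    by (auto simp: finite_vertex_pairs)
  have "measure_pmf.prob (gnp n p) {E. E \<inter> S = T} =
      measure_pmf.prob (Pi_pmf ?V False (\<lambda>_. bernoulli_pmf p)) (Pi ?V B)"
    unfolding gnp_def measure_map_pmf
    by (rule arg_cong2[where f = measure_pmf.prob])
       (use assms in \<open>auto simp: B_def Pi_def split: if_splits\<close>)
  also have "\<dots> = (\<Prod>e\<in>?V. measure_pmf.prob (bernoulli_pmf p) (B e))"
    by (rule measure_Pi_pmf_Pi) (rule fin)
  also have "\<dots> = (\<Prod>e\<in>S. if e \<in> T then p else 1 - p)"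
    using assms fin p
    by (intro prod.mono_neutral_cong_right) (auto simp: B_def measure_pmf_single)
  also have "\<dots> = p ^ card T * (1 - p) ^ card (S - T)"
  proof -
    have "S \<inter> {e. e \<in> T} = T" "S \<inter> - {e. e \<in> T} = S - T"
      using assms by auto
    then show ?thesis
      using fin by (simp add: prod.If_cases)
  qed
  finally show ?thesis .
qed

text \<open>A pair prescribed by both events is paid for once jointly but twice in the product, so a
  shared edge gains \<open>1 / p\<close> and a shared non-edge \<open>1 / (1 - p)\<close>. Charging
  \<open>1 / (1 - p)\<close> for every pair in \<open>S \<inter> S'\<close> weakens the bound but
  makes that factor depend on \<open>S\<close> and \<open>S'\<close> alone.\<close>

lemma prob_gnp_Int_eq_both_le:
  assumes p: "0 < p" "p < 1"
    and S: "S \<subseteq> vertex_pairs n" "T \<subseteq> S" and S': "S' \<subseteq> vertex_pairs n" "T' \<subseteq> S'"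
    and compat: "T \<inter> S' = T' \<inter> S"
  shows "measure_pmf.prob (gnp n p) {E. E \<inter> S = T \<and> E \<inter> S' = T'} \<le>
           measure_pmf.prob (gnp n p) {E. E \<inter> S = T} * measure_pmf.prob (gnp n p) {E. E \<inter> S' = T'} *
           ((1 / p) ^ card (T \<inter> T') * (1 / (1 - p)) ^ card (S \<inter> S'))"
proof -
  have fin: "finite S" "finite S'" "finite T" "finite T'"
    using S(2) S'(2) finite_subset[OF S(1) finite_vertex_pairs] finite_subset[OF S'(1) finite_vertex_pairs]
    by (auto intro: finite_subset)
  let ?D = "S - T" and ?D' = "S' - T'"
  have eq: "{E. E \<inter> S = T \<and> E \<inter> S' = T'} = {E. E \<inter> (S \<union> S') = T \<union> T'}"
    using S S' compat by auto
  have diff: "S \<union> S' - (T \<union> T') = ?D \<union> ?D'"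
    using S S' compat by auto
  have "p ^ card (T \<union> T') = p ^ card T * p ^ card T' * (1 / p) ^ card (T \<inter> T')"
  proof -
    have "card (T \<union> T') + card (T \<inter> T') = card T + card T'"
      using card_Un_Int fin by metis
    then have "p ^ card (T \<union> T') * p ^ card (T \<inter> T') = p ^ card T * p ^ card T'"
      by (simp add: power_add[symmetric])
    then show ?thesis using p by (simp add: field_simps)
  qed
  moreover have "(1 - p) ^ card (?D \<union> ?D') = (1 - p) ^ card ?D * (1 - p) ^ card ?D' * (1 / (1 - p)) ^ card (?D \<inter> ?D')"
  proof -
    have "card (?D \<union> ?D') + card (?D \<inter> ?D') = card ?D + card ?D'"
      using card_Un_Int fin by (metis finite_Diff)
    then have "(1 - p) ^ card (?D \<union> ?D') * (1 - p) ^ card (?D \<inter> ?D') = (1 - p) ^ card ?D * (1 - p) ^ card ?D'"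
      by (simp add: power_add[symmetric])
    then show ?thesis using p by (simp add: field_simps)
  qed
  moreover have "(1 / (1 - p)) ^ card (?D \<inter> ?D') \<le> (1 / (1 - p)) ^ card (S \<inter> S')"
    using p fin by (intro power_increasing card_mono) auto
  ultimately have "p ^ card (T \<union> T') * (1 - p) ^ card (?D \<union> ?D') \<le>
      (p ^ card T * (1 - p) ^ card ?D) * (p ^ card T' * (1 - p) ^ card ?D') *
      ((1 / p) ^ card (T \<inter> T') * (1 / (1 - p)) ^ card (S \<inter> S'))"
    using p by (simp add: mult_left_mono ac_simps)
  moreover have "measure_pmf.prob (gnp n p) {E. E \<inter> (S \<union> S') = T \<union> T'} =
      p ^ card (T \<union> T') * (1 - p) ^ card (?D \<union> ?D')"
    using S S' p by (subst prob_gnp_Int_eq) (auto simp: diff)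
  ultimately show ?thesis
    using S S' p by (simp add: eq prob_gnp_Int_eq)
qed

section \<open>Subsets of induced matchings and the vertex-Lipschitz property\<close>

lemma induced_edges_vertex_pairs:
  assumes "E \<subseteq> vertex_pairs n"
  shows "induced_edges E U = E \<inter> {e. e \<subseteq> U \<and> card e = 2}"
  using assms by (auto simp: induced_edges_def mem_vertex_pairs)

text \<open>An edge inside the vertices of \<open>M'\<close> lies inside those of \<open>M\<close>,
  hence belongs to \<open>M\<close>. If it were not in \<open>M'\<close>, it would be disjoint from
  the edges that cover it, hence empty.\<close>

lemma induced_matching_subset:
  assumes "induced_matching E M" "M' \<subseteq> M" "{} \<notin> E"
  shows "induced_matching E M'"
proof -
  have M: "M \<subseteq> E" "pairwise disjnt M" "induced_edges E (\<Union>M) = M"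
    using assms(1) by (auto simp: induced_matching_def)
  have "e \<in> M'" if e: "e \<in> E" "e \<subseteq> \<Union>M'" for e
  proof -
    have "e \<in> induced_edges E (\<Union>M)"
      using e assms(2) by (auto simp: induced_edges_def)
    then have "e \<in> M" by (simp only: M(3))
    show ?thesis
    proof (rule ccontr)
      assume "e \<notin> M'"
      have "disjnt e e'" if "e' \<in> M'" for e'
        by (rule pairwiseD[OF M(2) \<open>e \<in> M\<close>]) (use that \<open>e \<notin> M'\<close> assms(2) in auto)
      then have "e = {}"
        using e(2) by (auto simp: disjnt_def)
      then show False using e(1) assms(3) by simp
    qed
  qed
  then show ?thesis
    using M assms(2) by (auto simp: induced_matching_def induced_edges_def intro: pairwise_subset)
qed


text \<open>At most one edge of a maximum induced matching of \<open>E\<close> contains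
  \<open>v\<close>. Dropping it leaves an induced matching that avoids \<open>v\<close>, and there
  \<open>E\<close> and \<open>E'\<close> agree.\<close>

lemma induced_matching_number_le_Suc:
  assumes E: "E \<subseteq> vertex_pairs n" "E' \<subseteq> vertex_pairs n"
    and eq: "\<And>e. v \<notin> e \<Longrightarrow> e \<in> E \<longleftrightarrow> e \<in> E'"
  shows "induced_matching_number E \<le> Suc (induced_matching_number E')"
proof -
  obtain M where M: "induced_matching E M" "card M = induced_matching_number E"
    using induced_matching_number_attained(1)[OF E(1)] by blast
  define M' where "M' = {e \<in> M. v \<notin> e}"
  have M': "induced_matching E M'"
    using E(1) M(1) by (rule_tac induced_matching_subset) (auto simp: M'_def mem_vertex_pairs)
  have "v \<notin> \<Union>M'" by (auto simp: M'_def)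
  then have "induced_matching E' M'"
    using M' eq unfolding induced_matching_def induced_edges_def by blast
  then have "card M' \<le> induced_matching_number E'"
    by (rule induced_matching_number_attained(2)[OF E(2)])
  moreover have "card M \<le> Suc (card M')"
  proof -
    have disj: "pairwise disjnt M" and "finite M"
      using M(1) finite_subset[OF E(1) finite_vertex_pairs] by (auto simp: induced_matching_def intro: finite_subset)
    have "e = e'" if "e \<in> M - M'" "e' \<in> M - M'" for e e'
    proof (rule ccontr)
      assume "e \<noteq> e'"
      then have "disjnt e e'" using that disj by (auto simp: pairwise_def)
      then show False using that by (auto simp: M'_def disjnt_def)
    qed
    then have "card (M - M') \<le> Suc 0"
      by (intro card_le_Suc0_iff_eq[THEN iffD2]) (use \<open>finite M\<close> in auto)
    then show ?thesis
      using card_Diff_subset[of M' M] \<open>finite M\<close> by (auto simp: M'_def)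
  qed
  ultimately show ?thesis using M(2) by simp
qed

text \<open>Each pair is assigned to its larger vertex. This yields only \<open>n\<close>
  independent blocks, and changing block \<open>v\<close> alters only edges at \<open>v\<close>;
  with Lipschitz constant 1 the tail becomes \<open>exp (- 2 * t\<^sup>2 / n)\<close>.\<close>

lemma vertex_pairs_eq_UN: "vertex_pairs n = (\<Union>v\<in>{1..n}. {e \<in> vertex_pairs n. Max e = v})"
proof -
  have "Max e \<in> {1..n}" if "e \<in> vertex_pairs n" for e
  proof -
    have "finite e" "e \<noteq> {}" "e \<subseteq> {1..n}"
      using that by (auto simp: mem_vertex_pairs card_2_iff intro: finite_subset)
    then show ?thesis using Max_in[of e] by blast
  qed
  then show ?thesis by auto
qed

lemma induced_matching_number_concentration:
  fixes n :: nat and p t :: real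
  assumes "n \<ge> 1" "t > 0"
  defines "\<mu> \<equiv> measure_pmf.expectation (gnp n p) (\<lambda>E. real (induced_matching_number E))"
  shows "measure_pmf.prob (gnp n p) {E. real (induced_matching_number E) \<ge> \<mu> + t} \<le> exp (- 2 * t\<^sup>2 / n)"
    and "measure_pmf.prob (gnp n p) {E. real (induced_matching_number E) \<le> \<mu> - t} \<le> exp (- 2 * t\<^sup>2 / n)"
proof -
  let ?V = "vertex_pairs n"
  let ?P = "Pi_pmf ?V False (\<lambda>_. bernoulli_pmf p)"
  define f where "f g = real (induced_matching_number {e \<in> ?V. g e})" for g :: "nat set \<Rightarrow> bool"
  define B where "B v = {e \<in> ?V. Max e = v}" for v
  have V: "(\<Union>v\<in>{1..n}. B v) = ?V"
    using vertex_pairs_eq_UN[of n] by (simp add: B_def)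
  have B: "finite (B v)" for v
    by (simp add: B_def finite_vertex_pairs)
  have disj: "disjoint_family_on B {1..n}"
    by (auto simp: disjoint_family_on_def B_def)
  have lip: "f g - f h \<le> 1" if "\<And>e. e \<notin> B v \<Longrightarrow> g e = h e" for v g h
  proof -
    have "induced_matching_number {e \<in> ?V. g e} \<le> Suc (induced_matching_number {e \<in> ?V. h e})"
    proof (rule induced_matching_number_le_Suc[where v = v and n = n])
      fix e assume "v \<notin> e"
      have "e \<notin> B v"
      proof
        assume "e \<in> B v"
        then have "finite e" "e \<noteq> {}" "Max e = v"
          by (auto simp: B_def mem_vertex_pairs card_2_iff intro: finite_subset)
        then show False using Max_in[of e] \<open>v \<notin> e\<close> by simp
      qed
      then show "e \<in> {e \<in> ?V. g e} \<longleftrightarrow> e \<in> {e \<in> ?V. h e}"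
        using that by simp
    qed auto
    then show ?thesis by (simp add: f_def)
  qed
  have \<mu>: "\<mu> = measure_pmf.expectation ?P f"
    by (simp add: \<mu>_def gnp_def f_def[abs_def])
  have fin: "finite (set_pmf (bernoulli_pmf p))" by simp
  have "measure_pmf.prob ?P {g. f g \<ge> measure_pmf.expectation ?P f + t} \<le> exp (- 2 * t\<^sup>2 / (real (card {1..n}) * 1\<^sup>2))"
    unfolding V[symmetric]
    by (rule mcdiarmid[OF _ _ B disj fin _ _ lip]) (use assms in auto)
  then show "measure_pmf.prob (gnp n p) {E. real (induced_matching_number E) \<ge> \<mu> + t} \<le> exp (- 2 * t\<^sup>2 / n)"
    by (simp add: \<mu> gnp_def f_def vimage_def)
  have "measure_pmf.prob ?P {g. - f g \<ge> measure_pmf.expectation ?P (\<lambda>g. - f g) + t} \<le> exp (- 2 * t\<^sup>2 / (real (card {1..n}) * 1\<^sup>2))"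
    unfolding V[symmetric]
  proof (rule mcdiarmid[OF _ _ B disj fin])
    show "- f g - - f h \<le> 1" if "\<And>e. e \<notin> B v \<Longrightarrow> g e = h e" for v g h
      using lip[of v h g] that by simp
  qed (use assms in auto)
  moreover have "{g. - f g \<ge> measure_pmf.expectation ?P (\<lambda>g. - f g) + t} = {g. f g \<le> \<mu> - t}"
    by (auto simp: \<mu>)
  ultimately show "measure_pmf.prob (gnp n p) {E. real (induced_matching_number E) \<le> \<mu> - t} \<le> exp (- 2 * t\<^sup>2 / n)"
    by (simp add: gnp_def f_def vimage_def)
qed

section \<open>The second moment\<close>

text \<open>Cauchy-Schwarz for the number of events that occur and the indicator that some event
  occurs. The product form also covers a union of probability zero.\<close>

lemma (in prob_space) second_moment_events:
  assumes "finite F" and [measurable]: "\<And>i. i \<in> F \<Longrightarrow> A i \<in> events"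
  shows "(\<Sum>i\<in>F. prob (A i))\<^sup>2 \<le> prob (\<Union>i\<in>F. A i) * (\<Sum>i\<in>F. \<Sum>j\<in>F. prob (A i \<inter> A j))"
proof -
  let ?U = "\<Union>i\<in>F. A i"
  define X where "X x = (\<Sum>i\<in>F. indicat_real (A i) x)" for x
  define m where "m = (\<Sum>i\<in>F. prob (A i))"
  define v where "v = (\<Sum>i\<in>F. \<Sum>j\<in>F. prob (A i \<inter> A j))"
  define u where "u = prob ?U"
  have U [measurable]: "?U \<in> events" using assms by auto
  have X: "has_bochner_integral M X m"
    unfolding X_def m_def using assms
    by (auto intro!: has_bochner_integral_sum has_bochner_integral_real_indicator simp: emeasure_eq_measure)
  have X2: "has_bochner_integral M (\<lambda>x. (X x)\<^sup>2) v"
  proof -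
    have "(X x)\<^sup>2 = (\<Sum>i\<in>F. \<Sum>j\<in>F. indicat_real (A i \<inter> A j) x)" for x
      by (simp add: X_def power2_eq_square sum_product indicator_inter_arith)
    then show ?thesis
      unfolding v_def using assms
      by (auto intro!: has_bochner_integral_sum has_bochner_integral_real_indicator sets.Int
          simp: emeasure_eq_measure)
  qed
  have I: "has_bochner_integral M (indicat_real ?U) u"
    unfolding u_def using U by (intro has_bochner_integral_real_indicator) (auto simp: emeasure_eq_measure)
  \<comment> \<open>The quadratic in \<open>t\<close> is the expectation of the square of
    \<open>X - t * indicator ?U\<close>; since \<open>X\<close> vanishes off \<open>?U\<close>, the
    cross term is \<open>2 * t * m\<close>. Its minimiser \<open>t = m / u\<close> gives the
    claim.\<close>
  have nonneg: "0 \<le> v - 2 * t * m + t\<^sup>2 * u" for t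
  proof -
    have "(X x - t * indicator ?U x)\<^sup>2 = (X x)\<^sup>2 - 2 * t * X x + t\<^sup>2 * indicator ?U x" for x
    proof (cases "x \<in> ?U")
      case True
      then show ?thesis by (simp add: power2_eq_square algebra_simps)
    next
      case False
      then have "X x = 0" by (auto simp: X_def indicator_def)
      then show ?thesis using False by simp
    qed
    then have *: "has_bochner_integral M (\<lambda>x. (X x - t * indicator ?U x)\<^sup>2) (v - 2 * t * m + t\<^sup>2 * u)"
      using has_bochner_integral_add[OF has_bochner_integral_diff[OF X2 has_bochner_integral_mult_right[OF X, of "2 * t"]]
          has_bochner_integral_mult_right[OF I, of "t\<^sup>2"]] by simp
    show ?thesis
      unfolding has_bochner_integral_integral_eq[OF *, symmetric] by simp
  qed
  have "m\<^sup>2 \<le> u * v"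
  proof (cases "u = 0")
    case True
    have "prob (A i) = 0" if "i \<in> F" for i
    proof -
      have "prob (A i) \<le> u"
        unfolding u_def using that U by (intro finite_measure_mono) auto
      then show ?thesis using True measure_nonneg[of M "A i"] by linarith
    qed
    then show ?thesis using True by (simp add: m_def)
  next
    case False
    then have "u > 0" using measure_nonneg[of M ?U] by (simp add: u_def less_le)
    then show ?thesis
      using nonneg[of "m / u"] by (simp add: field_simps power2_eq_square)
  qed
  then show ?thesis by (simp add: m_def v_def u_def)
qed

text \<open>
  A placement assigns distinct vertices to the \<open>2 k\<close> slots \<open>(i, b)\<close>; the slots \<open>(i, False)\<close> and
  \<open>(i, True)\<close> hold the ends of the \<open>i\<close>-th edge.
\<close>
definition slots :: "nat \<Rightarrow> (nat \<times> bool) set" where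
  "slots k = {..<k} \<times> UNIV"

definition placements :: "nat \<Rightarrow> nat \<Rightarrow> (nat \<times> bool \<Rightarrow> nat) set" where
  "placements k n = {f \<in> slots k \<rightarrow>\<^sub>E {1..n}. inj_on f (slots k)}"

definition placed_edge :: "(nat \<times> bool \<Rightarrow> nat) \<Rightarrow> nat \<Rightarrow> nat set" where
  "placed_edge f i = f ` ({i} \<times> UNIV)"

definition placed_matching :: "nat \<Rightarrow> (nat \<times> bool \<Rightarrow> nat) \<Rightarrow> nat set set" where
  "placed_matching k f = placed_edge f ` {..<k}"

definition pairs_in :: "'a set \<Rightarrow> 'a set set" where
  "pairs_in U = {e. e \<subseteq> U \<and> card e = 2}"

lemma finite_slots [simp]: "finite (slots k)"
  by (simp add: slots_def)

lemma card_slots [simp]: "card (slots k) = 2 * k"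
  by (simp add: slots_def card_cartesian_product)

lemma finite_placements [simp]: "finite (placements k n)"
  by (rule finite_subset[of _ "slots k \<rightarrow>\<^sub>E {1..n}"]) (auto simp: placements_def intro: finite_PiE)

lemma card_placements: "card (placements k n) = prod ((-) n) {0..<2 * k}"
  using card_inj_on_subset_funcset[of "slots k" "{1..n}" "slots k"] by (simp add: placements_def)

lemma placed_edge_eq: "placed_edge f i = {f (i, False), f (i, True)}"
  by (auto simp: placed_edge_def UNIV_bool)

lemma Union_placed_matching: "\<Union>(placed_matching k f) = f ` slots k"
  by (auto simp: placed_matching_def placed_edge_def slots_def)

lemma placements_eqD:
  assumes "f \<in> placements k n" "f x = f y" "x \<in> slots k" "y \<in> slots k"
  shows "x = y"
  using assms by (auto simp: placements_def inj_on_def)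

lemma card_pairs_in: "finite U \<Longrightarrow> card (pairs_in U) = card U choose 2"
  by (simp add: pairs_in_def n_subsets)

lemma pairs_in_Int: "pairs_in U \<inter> pairs_in U' = pairs_in (U \<inter> U')"
  by (auto simp: pairs_in_def)

context
  fixes f :: "nat \<times> bool \<Rightarrow> nat" and k n :: nat
  assumes f: "f \<in> placements k n"
begin

lemma card_placed_vertices: "card (f ` slots k) = 2 * k"
  using f by (simp add: placements_def card_image)

lemma pairs_in_placed_subset: "pairs_in (f ` slots k) \<subseteq> vertex_pairs n"
  using f by (fastforce simp: placements_def pairs_in_def mem_vertex_pairs)

lemma card_placed_edge: "i < k \<Longrightarrow> card (placed_edge f i) = 2"
  using placements_eqD[OF f, of "(i, False)" "(i, True)"] by (auto simp: placed_edge_eq slots_def card_insert_if)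

lemma placed_matching_subset: "placed_matching k f \<subseteq> pairs_in (f ` slots k)"
  using card_placed_edge by (auto simp: placed_matching_def pairs_in_def placed_edge_eq slots_def)

lemma placed_edge_meetD:
  assumes "i < k" "j < k" "x \<in> placed_edge f i" "x \<in> placed_edge f j"
  shows "i = j"
  using assms placements_eqD[OF f, of "(i, _)" "(j, _)"] by (auto simp: placed_edge_def slots_def)

lemma inj_on_placed_edge: "inj_on (placed_edge f) {..<k}"
  using placed_edge_meetD by (intro inj_onI) (auto simp: placed_edge_eq)

lemma card_placed_matching: "card (placed_matching k f) = k"
  by (simp add: placed_matching_def card_image inj_on_placed_edge)

lemma disjoint_placed_matching: "pairwise disjnt (placed_matching k f)"
  using placed_edge_meetD by (auto simp: pairwise_def placed_matching_def disjnt_def)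

lemma induced_placed_matching:
  assumes "E \<subseteq> vertex_pairs n" "E \<inter> pairs_in (f ` slots k) = placed_matching k f"
  shows "induced_matching E (placed_matching k f)"
  using assms disjoint_placed_matching induced_edges_vertex_pairs[OF assms(1)]
  by (auto simp: induced_matching_def Union_placed_matching pairs_in_def)

end

text \<open>For each edge of \<open>g\<close>, the pattern records which of its ends fall on
  vertices of \<open>f\<close>, but not on which vertices. Restricting to indices below
  \<open>k\<close> leaves finitely many patterns to sum over.\<close>

definition overlap :: "nat \<Rightarrow> (nat \<times> bool \<Rightarrow> nat) \<Rightarrow> (nat \<times> bool \<Rightarrow> nat) \<Rightarrow> nat \<Rightarrow> bool set" where
  "overlap k f g = (\<lambda>i\<in>{..<k}. {b. g (i, b) \<in> f ` slots k})"

text \<open>The two placements prescribe the same edges on the pairs they share; otherwise no graph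
  contains both as induced matchings on their vertex sets.\<close>

definition compatible :: "nat \<Rightarrow> (nat \<times> bool \<Rightarrow> nat) \<Rightarrow> (nat \<times> bool \<Rightarrow> nat) \<Rightarrow> bool" where
  "compatible k f g \<longleftrightarrow>
     placed_matching k f \<inter> pairs_in (g ` slots k) = placed_matching k g \<inter> pairs_in (f ` slots k)"

section \<open>Counting second placements by overlap pattern\<close>

lemma card_Int_placed_vertices:
  assumes "g \<in> placements k n"
  shows "card (f ` slots k \<inter> g ` slots k) = (\<Sum>i<k. card (overlap k f g i))"
proof -
  have "f ` slots k \<inter> g ` slots k = g ` (SIGMA i:{..<k}. overlap k f g i)"
  proof (intro subset_antisym subsetI)
    fix x assume "x \<in> f ` slots k \<inter> g ` slots k"
    then have x: "x \<in> f ` slots k" and "x \<in> g ` slots k" by simp_all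
    from this(2) obtain z where z: "x = g z" "z \<in> slots k" by (rule imageE)
    obtain i b where ib: "z = (i, b)" by (rule prod.exhaust)
    have "i < k" "x = g (i, b)" "g (i, b) \<in> f ` slots k"
      using x z by (simp_all add: ib slots_def)
    then show "x \<in> g ` (SIGMA i:{..<k}. overlap k f g i)"
      by (intro image_eqI[of _ _ "(i, b)"]) (auto simp: overlap_def)
  qed (auto simp: overlap_def slots_def)
  moreover have "inj_on g (SIGMA i:{..<k}. overlap k f g i)"
    using assms by - (rule inj_on_subset[of g "slots k"], auto simp: placements_def slots_def)
  ultimately show ?thesis
    by (simp add: card_image card_SigmaI)
qed

lemma placed_edge_in_matching:
  assumes "g \<in> placements k n" "compatible k f g" "i < k" "overlap k f g i = UNIV"
  shows "placed_edge g i \<in> placed_matching k f"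
proof -
  have "placed_edge g i \<in> pairs_in (f ` slots k)"
    using assms card_placed_edge[OF assms(1,3)] by (auto simp: overlap_def pairs_in_def placed_edge_def)
  then show ?thesis
    using assms(2,3) by (auto simp: compatible_def placed_matching_def)
qed

text \<open>An edge of \<open>g\<close> with both ends on vertices of \<open>f\<close> is a pair
  prescribed by both placements, so compatibility makes it an edge of \<open>f\<close>. Conversely,
  a common edge has both ends there.\<close>

lemma card_common_edges:
  assumes g: "g \<in> placements k n" and "compatible k f g"
  shows "card (placed_matching k f \<inter> placed_matching k g) = card {i \<in> {..<k}. overlap k f g i = UNIV}"
proof -
  have "placed_matching k f \<inter> placed_matching k g = placed_edge g ` {i \<in> {..<k}. overlap k f g i = UNIV}"
    (is "?L = ?R")
  proof (intro subset_antisym subsetI)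
    fix e assume e: "e \<in> ?L"
    then obtain i where i: "i < k" "e = placed_edge g i"
      by (auto simp: placed_matching_def)
    have "e \<subseteq> f ` slots k"
      using e Union_placed_matching[of k f] by blast
    then have "overlap k f g i = UNIV"
      using i by (auto simp: overlap_def placed_edge_def)
    then show "e \<in> ?R" using i by auto
  next
    fix e assume "e \<in> ?R"
    then show "e \<in> ?L"
      using placed_edge_in_matching[OF assms] by (auto simp: placed_matching_def)
  qed
  moreover have "inj_on (placed_edge g) {i \<in> {..<k}. overlap k f g i = UNIV}"
    by (rule inj_on_subset[OF inj_on_placed_edge[OF g]]) auto
  ultimately show ?thesis
    by (simp add: card_image)
qed

text \<open>
  A slot paired with an earlier slot that is also mapped into the vertices of \<open>f\<close> carries no
  information: compatibility forces the pair to be mapped onto an edge of \<open>f\<close>.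
\<close>
lemma card_overlap_le:
  assumes f: "f \<in> placements k n" and t: "t \<in> {..<k} \<rightarrow>\<^sub>E UNIV"
  shows "card {g \<in> placements k n. compatible k f g \<and> overlap k f g = t} \<le>
           (2 * k) ^ card {i \<in> {..<k}. t i \<noteq> {}} *
           prod ((-) (n - 2 * k)) {0..<2 * k - (\<Sum>i<k. card (t i))}"
proof -
  let ?U = "f ` slots k"
  let ?G = "{g \<in> placements k n. compatible k f g \<and> overlap k f g = t}"
  \<comment> \<open>\<open>R\<close> picks one representative slot for each edge of \<open>g\<close>
    that meets \<open>f\<close>: the \<open>False\<close> slot if it is overlapped, otherwise the
    \<open>True\<close> slot. \<open>D\<close> collects the slots mapped outside
    \<open>?U\<close>.\<close>
  define R where "R = (\<lambda>i. (i, False \<notin> t i)) ` {i \<in> {..<k}. t i \<noteq> {}}"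
  define D where "D = slots k - Sigma {..<k} t"
  let ?T = "(R \<rightarrow>\<^sub>E ?U) \<times> {g \<in> D \<rightarrow>\<^sub>E ({1..n} - ?U). inj_on g D}"
  have R: "R \<subseteq> slots k" "finite R" "card R = card {i \<in> {..<k}. t i \<noteq> {}}"
    by (auto simp: R_def slots_def card_image inj_on_def)
  have D: "D \<subseteq> slots k" "finite D" "card D = 2 * k - (\<Sum>i<k. card (t i))"
    by (auto simp: D_def card_Diff_subset slots_def card_SigmaI Sigma_mono card_cartesian_product
        intro!: card_Diff_subset[THEN trans] finite_SigmaI)
  have cU: "card ?U = 2 * k" by (rule card_placed_vertices[OF f])
  have U: "?U \<subseteq> {1..n}" "finite ?U" using f by (auto simp: placements_def)
  have mem: "g (i, b) \<in> ?U \<longleftrightarrow> b \<in> t i" if "g \<in> ?G" "i < k" for g i b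
    using that by (auto simp: overlap_def)
  have image: "(\<lambda>g. (restrict g R, restrict g D)) ` ?G \<subseteq> ?T"
  proof clarify
    fix g assume g: "g \<in> placements k n" "compatible k f g" and t: "t = overlap k f g"
    then have gG: "g \<in> ?G" by simp
    have "g x \<in> ?U" if "x \<in> R" for x
    proof -
      obtain i where i: "i < k" "t i \<noteq> {}" "x = (i, False \<notin> t i)"
        using \<open>x \<in> R\<close> unfolding R_def by blast
      then have "(False \<notin> t i) \<in> t i"
        by (cases "False \<in> t i") (auto, metis (full_types))
      then show ?thesis using mem[OF gG i(1)] i(3) by simp
    qed
    moreover have "g x \<in> {1..n} - ?U" if "x \<in> D" for x
    proof -
      obtain i b where i: "i < k" "b \<notin> t i" "x = (i, b)"
        using \<open>x \<in> D\<close> by (auto simp: D_def slots_def)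
      then show ?thesis using mem[OF gG i(1)] g(1) by (auto simp: placements_def slots_def)
    qed
    moreover have "inj_on g D"
      using g(1) D(1) by - (rule inj_on_subset[of g "slots k"], auto simp: placements_def)
    ultimately show "restrict g R \<in> R \<rightarrow>\<^sub>E ?U \<and> restrict g D \<in> {g \<in> D \<rightarrow>\<^sub>E ({1..n} - ?U). inj_on g D}"
      by (auto simp: inj_on_def)
  qed
  have inj: "inj_on (\<lambda>g. (restrict g R, restrict g D)) ?G"
  proof (rule inj_onI)
    fix g h assume gh: "g \<in> ?G" "h \<in> ?G"
      and eq: "(restrict g R, restrict g D) = (restrict h R, restrict h D)"
    have eqR: "g x = h x" if "x \<in> R" for x
      using eq that by (metis prod.inject restrict_apply')
    have eqD: "g x = h x" if "x \<in> D" for x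
      using eq that by (metis prod.inject restrict_apply')
    have "g (i, b) = h (i, b)" if i: "i < k" for i b
    proof (cases "b \<notin> t i \<or> b = (False \<notin> t i)")
      case True
      then have "(i, b) \<in> R \<or> (i, b) \<in> D" using i by (auto simp: R_def D_def slots_def)
      then show ?thesis using eqR eqD by blast
    next
      case False
      \<comment> \<open>Only the \<open>True\<close> slot of a fully overlapped edge is left. The
        edges of \<open>g\<close> and \<open>h\<close> at \<open>i\<close> are both edges of the
        matching of \<open>f\<close> and share the end at \<open>False\<close>; by disjointness they
        coincide, and so do their other ends.\<close>
      then have b: "b = True" and t: "t i = UNIV"
        by (auto simp: UNIV_bool)
      have "(i, False) \<in> R" using i t by (auto simp: R_def)
      then have eq: "g (i, False) = h (i, False)" by (rule eqR)
      have "placed_edge g i \<in> placed_matching k f" "placed_edge h i \<in> placed_matching k f"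
        using gh t i by (auto intro!: placed_edge_in_matching)
      moreover have "\<not> disjnt (placed_edge g i) (placed_edge h i)"
        using eq by (auto simp: placed_edge_eq disjnt_def)
      ultimately have "placed_edge g i = placed_edge h i"
        using disjoint_placed_matching[OF f] by (auto simp: pairwise_def)
      moreover have "g (i, True) \<noteq> g (i, False)" "h (i, True) \<noteq> h (i, False)"
        using gh i by (auto dest: placements_eqD simp: slots_def)
      ultimately show ?thesis
        using eq b by (auto simp: placed_edge_eq doubleton_eq_iff)
    qed
    then show "g = h"
      using gh by (intro PiE_ext[of g "slots k" "\<lambda>_. {1..n}" h]) (auto simp: placements_def slots_def)
  qed
  have fin: "finite ?T"
    using R D U by (intro finite_cartesian_product finite_PiE finite_subset[of "{g \<in> D \<rightarrow>\<^sub>E ({1..n} - ?U). inj_on g D}" "D \<rightarrow>\<^sub>E ({1..n} - ?U)"]) auto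
  have "card ?G \<le> card ?T"
    by (rule card_inj_on_le[OF inj image fin])
  also have "\<dots> = (2 * k) ^ card {i \<in> {..<k}. t i \<noteq> {}} *
           prod ((-) (n - 2 * k)) {0..<2 * k - (\<Sum>i<k. card (t i))}"
    using card_inj_on_subset_funcset[of D "{1..n} - ?U" D] R D U cU
    by (simp add: card_cartesian_product card_PiE card_Diff_subset)
  finally show ?thesis .
qed

text \<open>The first \<open>u - w\<close> factors each shrink by at least the ratio
  \<open>(N - u) / N\<close> when \<open>N\<close> is replaced by \<open>N - u\<close>; each of the
  last \<open>w\<close> factors of the full product is at least \<open>N - u\<close>.\<close>

lemma falling_factorial_ratio_le:
  fixes N u w :: nat
  assumes "2 * u \<le> N" "0 < N" "w \<le> u"
  shows "real (prod ((-) (N - u)) {0..<u - w}) \<le>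
           real (prod ((-) N) {0..<u}) * ((real N - real u) / N) ^ (u - w) / (real N - real u) ^ w"
proof -
  define \<rho> where "\<rho> = (real N - real u) / N"
  have pos: "real N - real u > 0" using assms by linarith
  then have "\<rho> \<ge> 0" by (simp add: \<rho>_def)
  have split: "prod ((-) N) {0..<u} = prod ((-) N) {0..<u - w} * prod ((-) N) {u - w..<u}"
    by (simp add: prod.atLeastLessThan_concat)
  have "real (prod ((-) (N - u)) {0..<u - w}) \<le> (\<Prod>i\<in>{0..<u - w}. \<rho> * real (N - i))"
    unfolding of_nat_prod
  proof (rule prod_mono)
    fix i assume "i \<in> {0..<u - w}"
    then have i: "i < u" by auto
    have "(real N - real u - real i) * real N \<le> (real N - real u) * (real N - real i)"
      by (simp add: algebra_simps)
    then have "real N - real u - real i \<le> \<rho> * (real N - real i)"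
      using assms by (simp add: \<rho>_def field_simps)
    then show "0 \<le> real (N - u - i) \<and> real (N - u - i) \<le> \<rho> * real (N - i)"
      using i assms by (simp add: of_nat_diff)
  qed
  also have "\<dots> = \<rho> ^ (u - w) * real (prod ((-) N) {0..<u - w})"
    by (simp add: prod.distrib)
  finally have 1: "real (prod ((-) (N - u)) {0..<u - w}) \<le> \<rho> ^ (u - w) * real (prod ((-) N) {0..<u - w})" .
  have "(\<Prod>i\<in>{u - w..<u}. real N - real u) \<le> (\<Prod>i\<in>{u - w..<u}. real (N - i))"
    using pos assms by (intro prod_mono) (auto simp: of_nat_diff)
  then have 2: "(real N - real u) ^ w \<le> real (prod ((-) N) {u - w..<u})"
    using assms by simp
  have "real (prod ((-) (N - u)) {0..<u - w}) * (real N - real u) ^ w \<le>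
      (\<rho> ^ (u - w) * real (prod ((-) N) {0..<u - w})) * real (prod ((-) N) {u - w..<u})"
    using pos \<open>\<rho> \<ge> 0\<close> by (intro mult_mono 1 2 mult_nonneg_nonneg zero_le_power of_nat_0_le_iff) auto
  then show ?thesis
    using pos by (simp add: split \<rho>_def field_simps)
qed

text \<open>Factor contributed by one edge of the second placement: 1, \<open>a\<close> or
  \<open>b\<close> according to whether none, one or both of its ends are shared.\<close>

definition overlap_weight :: "real \<Rightarrow> real \<Rightarrow> bool set \<Rightarrow> real" where
  "overlap_weight a b Y = (if Y = {} then 1 else if Y = UNIV then b else a)"

lemma prod_if_one: "finite A \<Longrightarrow> (\<Prod>i\<in>A. if P i then c else 1) = c ^ card {i \<in> A. P i}"
  for c :: "'a :: comm_monoid_mult"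
  by (simp add: prod.If_cases Int_def)

lemma bool_set_cases: "Y = {} \<or> Y = {True} \<or> Y = {False} \<or> Y = UNIV" for Y :: "bool set"
proof -
  have "Y \<in> Pow {False, True}" by (metis PowI UNIV_bool top_greatest)
  then have "Y \<in> {{}, {True}, {False}, {False, True}}"
    unfolding Pow_insert Pow_empty by fastforce
  then show ?thesis by (simp add: UNIV_bool)
qed

text \<open>Here \<open>c\<close> is paid once per edge meeting the first placement (choice of the
  representative), \<open>d\<close> once per shared edge, and \<open>x\<close> once per shared
  vertex.\<close>

lemma prod_overlap_weight:
  fixes k :: nat
  shows
  "(\<Prod>i<k. overlap_weight (c * x) (c * d * x\<^sup>2) (t i)) =
     c ^ card {i \<in> {..<k}. t i \<noteq> {}} * d ^ card {i \<in> {..<k}. t i = UNIV} * x ^ (\<Sum>i<k. card (t i))"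
proof -
  have "overlap_weight (c * x) (c * d * x\<^sup>2) Y =
      (if Y \<noteq> {} then c else 1) * (if Y = UNIV then d else 1) * x ^ card Y" for Y
  proof -
    have "{True} \<noteq> UNIV" "{False} \<noteq> UNIV" by (auto simp: UNIV_bool)
    with bool_set_cases[of Y] show ?thesis
      by (elim disjE) (simp_all add: overlap_weight_def power2_eq_square)
  qed
  moreover have "(\<Prod>i<k. if t i \<noteq> {} then c else 1) = c ^ card {i \<in> {..<k}. t i \<noteq> {}}"
    "(\<Prod>i<k. if t i = UNIV then d else 1) = d ^ card {i \<in> {..<k}. t i = UNIV}"
    using prod_if_one[of "{..<k}" "\<lambda>i. t i \<noteq> {}" c] prod_if_one[of "{..<k}" "\<lambda>i. t i = UNIV" d]
    by simp_all
  ultimately show ?thesis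
    by (simp only: prod.distrib power_sum)
qed

text \<open>The second moment inequality for the events \<open>A f\<close>, divided by the squared
  expectation; the factor after the probability bounds \<open>E X\<^sup>2 / (E X)\<^sup>2\<close>.
  Second placements are grouped by pattern. The weight \<open>2 * k\<close> counts the images of a
  representative slot, \<open>1 / p\<close> comes from a shared edge, and \<open>x\<close>, roughly
  \<open>1 / n\<close>, is the price of a shared vertex.\<close>

lemma prob_induced_matching_ge:
  fixes p :: real and k n :: nat
  assumes p: "0 < p" "p < 1" and n: "4 * k \<le> n" "0 < n"
  defines "\<rho> \<equiv> (real n - 2 * real k) / n"
  defines "x \<equiv> n / (real n - 2 * real k)\<^sup>2"
  shows "1 \<le> measure_pmf.prob (gnp n p) {E. k \<le> induced_matching_number E} *
           (\<rho> ^ (2 * k) * (\<Sum>t\<in>{..<k} \<rightarrow>\<^sub>E UNIV.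
              (\<Prod>i<k. overlap_weight (real (2 * k) * x) (real (2 * k) * (1 / p) * x\<^sup>2) (t i)) *
              (1 / (1 - p)) ^ ((\<Sum>i<k. card (t i)) choose 2)))"
    (is "1 \<le> ?P * (_ * ?R)")
proof -
  define F where "F = placements k n"
  define A where "A f = {E. E \<inter> pairs_in (f ` slots k) = placed_matching k f}" for f :: "nat \<times> bool \<Rightarrow> nat"
  \<comment> \<open>The common probability of all events \<open>A f\<close>: \<open>k\<close> pairs
    are edges and the other pairs inside the \<open>2 * k\<close> vertices are not.\<close>
  define \<pi> where "\<pi> = p ^ k * (1 - p) ^ ((2 * k choose 2) - k)"
  define T :: "(nat \<Rightarrow> bool set) set" where "T = {..<k} \<rightarrow>\<^sub>E UNIV"
  define w where "w t = (\<Sum>i<k. card (t i))" for t :: "nat \<Rightarrow> bool set"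
  define wt where "wt t = (1 / p) ^ card {i \<in> {..<k}. t i = UNIV} * (1 / (1 - p)) ^ (w t choose 2)"
    for t :: "nat \<Rightarrow> bool set"
  let ?prob = "measure_pmf.prob (gnp n p)"
  have pos: "real n - 2 * real k > 0" using n by linarith
  have "\<pi> > 0" using p by (simp add: \<pi>_def)
  have finF: "finite F" by (simp add: F_def)
  have finT: "finite T" by (auto simp: T_def intro!: finite_PiE)
  have cF: "real (card F) > 0"
    using n by (auto simp: F_def card_placements intro!: prod_pos)
  have prob_A: "?prob (A f) = \<pi>" if "f \<in> F" for f
  proof -
    have f: "f \<in> placements k n" using that by (simp add: F_def)
    have fin: "finite (placed_matching k f)" "finite (f ` slots k)"
      by (simp_all add: placed_matching_def)
    show ?thesis
      unfolding A_def using f p fin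
      by (simp add: prob_gnp_Int_eq pairs_in_placed_subset placed_matching_subset card_Diff_subset
          card_pairs_in card_placed_vertices card_placed_matching \<pi>_def)
  qed
  have joint: "?prob (A f \<inter> A g) \<le> (if compatible k f g then \<pi>\<^sup>2 * wt (overlap k f g) else 0)"
    if "f \<in> F" "g \<in> F" for f g
  proof (cases "compatible k f g")
    case True
    have fg: "f \<in> placements k n" "g \<in> placements k n" using that by (simp_all add: F_def)
    have "?prob (A f \<inter> A g) \<le> ?prob (A f) * ?prob (A g) *
        ((1 / p) ^ card (placed_matching k f \<inter> placed_matching k g) *
         (1 / (1 - p)) ^ card (pairs_in (f ` slots k) \<inter> pairs_in (g ` slots k)))"
      using prob_gnp_Int_eq_both_le[OF p pairs_in_placed_subset[OF fg(1)] placed_matching_subset[OF fg(1)]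
          pairs_in_placed_subset[OF fg(2)] placed_matching_subset[OF fg(2)]] True
      by (simp add: compatible_def A_def Int_def)
    also have "\<dots> = \<pi>\<^sup>2 * wt (overlap k f g)"
      using card_Int_placed_vertices[OF fg(2), of f] card_common_edges[OF fg(2) True]
      by (simp add: prob_A that wt_def w_def pairs_in_Int card_pairs_in power2_eq_square)
    finally show ?thesis using True by simp
  next
    case False
    then have "A f \<inter> A g = {}"
      by (auto simp: A_def compatible_def)
    then show ?thesis using False by simp
  qed
  have count: "real (card {g \<in> F. compatible k f g \<and> overlap k f g = t}) * wt t \<le>
      real (card F) * (\<rho> ^ (2 * k) *
        ((\<Prod>i<k. overlap_weight (real (2 * k) * x) (real (2 * k) * (1 / p) * x\<^sup>2) (t i)) *
         (1 / (1 - p)) ^ (w t choose 2)))" (is "real ?c * _ \<le> _")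
    if "f \<in> F" "t \<in> T" for f t
  proof -
    let ?ne = "card {i \<in> {..<k}. t i \<noteq> {}}"
    have "card (t i) \<le> 2" for i
      using card_mono[of "UNIV :: bool set" "t i"] by simp
    then have w: "w t \<le> 2 * k"
      using sum_mono[of "{..<k}" "\<lambda>i. card (t i)" "\<lambda>_. 2"] by (simp add: w_def)
    have "?c \<le> (2 * k) ^ ?ne * prod ((-) (n - 2 * k)) {0..<2 * k - w t}"
      using card_overlap_le[of f k n t] that unfolding F_def T_def w_def by blast
    then have "real ?c \<le> real ((2 * k) ^ ?ne * prod ((-) (n - 2 * k)) {0..<2 * k - w t})"
      by (simp only: of_nat_le_iff)
    also have "\<dots> = real (2 * k) ^ ?ne * real (prod ((-) (n - 2 * k)) {0..<2 * k - w t})"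
      by simp
    also have "\<dots> \<le> real (2 * k) ^ ?ne * (real (card F) * (\<rho> ^ (2 * k - w t) / (real n - 2 * real k) ^ w t))"
      using falling_factorial_ratio_le[of "2 * k" n "w t"] n w
      by (intro mult_left_mono) (simp_all add: F_def card_placements \<rho>_def)
    \<comment> \<open>Each shared vertex removes one factor \<open>\<rho>\<close> and brings
      \<open>1 / (n - 2 * k)\<close>, and \<open>1 / (\<rho> * (n - 2 * k))\<close> is
      \<open>x\<close>.\<close>
    also have "\<rho> ^ (2 * k - w t) / (real n - 2 * real k) ^ w t = \<rho> ^ (2 * k) * x ^ w t"
    proof -
      have "\<rho> > 0" using pos n by (simp add: \<rho>_def)
      then have "\<rho> ^ (2 * k - w t) = \<rho> ^ (2 * k) / \<rho> ^ w t"
        using w by (simp add: power_diff)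
      moreover have "1 / \<rho> ^ w t / (real n - 2 * real k) ^ w t = x ^ w t"
        using pos n by (simp add: \<rho>_def x_def power_divide power2_eq_square power_mult_distrib)
      ultimately show ?thesis by (metis divide_divide_eq_left mult.right_neutral times_divide_eq_right)
    qed
    finally have "real ?c \<le> real (2 * k) ^ ?ne * (real (card F) * (\<rho> ^ (2 * k) * x ^ w t))" .
    then have "real ?c * wt t \<le> real (2 * k) ^ ?ne * (real (card F) * (\<rho> ^ (2 * k) * x ^ w t)) * wt t"
      using p by (intro mult_right_mono) (auto simp: wt_def)
    then show ?thesis
      unfolding prod_overlap_weight wt_def w_def by (simp only: ac_simps)
  qed
  have row: "(\<Sum>g\<in>F. ?prob (A f \<inter> A g)) \<le> \<pi>\<^sup>2 * (real (card F) * (\<rho> ^ (2 * k) * ?R))" if f: "f \<in> F" for f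
  proof -
    let ?F = "{g \<in> F. compatible k f g}"
    have "(\<Sum>g\<in>F. ?prob (A f \<inter> A g)) \<le> (\<Sum>g\<in>F. if compatible k f g then \<pi>\<^sup>2 * wt (overlap k f g) else 0)"
      by (intro sum_mono joint f)
    also have "\<dots> = (\<Sum>g\<in>?F. \<pi>\<^sup>2 * wt (overlap k f g))"
      using finF by (simp add: sum.inter_filter)
    also have "\<dots> = (\<Sum>t\<in>T. \<Sum>g\<in>{g \<in> ?F. overlap k f g = t}. \<pi>\<^sup>2 * wt (overlap k f g))"
      using finF finT by (intro sum.group[symmetric]) (auto simp: T_def overlap_def)
    also have "\<dots> = (\<Sum>t\<in>T. \<pi>\<^sup>2 * (real (card {g \<in> F. compatible k f g \<and> overlap k f g = t}) * wt t))"
      by (intro sum.cong refl) (auto simp: conj_assoc)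
    also have "\<dots> \<le> (\<Sum>t\<in>T. \<pi>\<^sup>2 * (real (card F) * (\<rho> ^ (2 * k) *
        ((\<Prod>i<k. overlap_weight (real (2 * k) * x) (real (2 * k) * (1 / p) * x\<^sup>2) (t i)) *
         (1 / (1 - p)) ^ (w t choose 2)))))"
      by (intro sum_mono mult_left_mono count f) auto
    also have "\<dots> = \<pi>\<^sup>2 * (real (card F) * (\<rho> ^ (2 * k) * ?R))"
      by (simp add: sum_distrib_left T_def w_def)
    finally show ?thesis .
  qed
  have Un: "?prob (\<Union>f\<in>F. A f) \<le> ?P"
  proof -
    \<comment> \<open>Passing to the support guarantees that \<open>E\<close> consists of vertex
      pairs.\<close>
    have "?prob (\<Union>f\<in>F. A f) = ?prob ((\<Union>f\<in>F. A f) \<inter> set_pmf (gnp n p))"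
      by (simp add: measure_Int_set_pmf)
    also have "\<dots> \<le> ?P"
    proof (rule measure_pmf.finite_measure_mono)
      show "(\<Union>f\<in>F. A f) \<inter> set_pmf (gnp n p) \<subseteq> {E. k \<le> induced_matching_number E}"
      proof clarify
        fix E f assume "E \<in> set_pmf (gnp n p)" "f \<in> F" "E \<in> A f"
        then have E: "E \<subseteq> vertex_pairs n" and f: "f \<in> placements k n"
          and eq: "E \<inter> pairs_in (f ` slots k) = placed_matching k f"
          by (auto simp: set_pmf_gnp_subset F_def A_def)
        then show "k \<le> induced_matching_number E"
          using induced_matching_number_attained(2)[OF E induced_placed_matching[OF f E eq]]
          by (simp add: card_placed_matching[OF f])
      qed
    qed simp
    finally show ?thesis .
  qed
  have "0 \<le> \<rho> ^ (2 * k) * ?R"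
    using pos n p by (intro mult_nonneg_nonneg sum_nonneg prod_nonneg)
      (auto simp: \<rho>_def overlap_weight_def x_def)
  have "(real (card F) * \<pi>)\<^sup>2 \<le> ?prob (\<Union>f\<in>F. A f) * (\<Sum>f\<in>F. \<Sum>g\<in>F. ?prob (A f \<inter> A g))"
    using measure_pmf.second_moment_events[OF finF, of A "gnp n p"] by (simp add: prob_A)
  also have "\<dots> \<le> ?prob (\<Union>f\<in>F. A f) * (\<Sum>f\<in>F. \<pi>\<^sup>2 * (real (card F) * (\<rho> ^ (2 * k) * ?R)))"
    by (intro mult_left_mono sum_mono row) auto
  also have "\<dots> = (real (card F) * \<pi>)\<^sup>2 * (?prob (\<Union>f\<in>F. A f) * (\<rho> ^ (2 * k) * ?R))"
    by (simp add: power2_eq_square)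
  also have "\<dots> \<le> (real (card F) * \<pi>)\<^sup>2 * (?P * (\<rho> ^ (2 * k) * ?R))"
    using Un \<open>0 \<le> \<rho> ^ (2 * k) * ?R\<close> by (intro mult_left_mono mult_right_mono) auto
  finally show ?thesis
    using cF \<open>\<pi> > 0\<close> by simp
qed

section \<open>Estimating the sum over overlap patterns\<close>

text \<open>The sum factors over the \<open>k\<close> edges, and the four subsets of
  \<open>bool\<close> contribute \<open>1\<close>, \<open>a * z\<close>, \<open>a * z\<close> and
  \<open>b * z\<^sup>2\<close>.\<close>

lemma sum_prod_overlap_weight:
  fixes k :: nat
  shows "(\<Sum>t\<in>{..<k} \<rightarrow>\<^sub>E UNIV. (\<Prod>i<k. overlap_weight a b (t i)) * z ^ (\<Sum>i<k. card (t i))) =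
           (1 + 2 * a * z + b * z\<^sup>2) ^ k"
proof -
  have UN: "(UNIV :: bool set set) = {{}, {False}, {True}, UNIV}"
    using bool_set_cases by blast
  have neq: "{True} \<noteq> UNIV" "{False} \<noteq> UNIV" by (auto simp: UNIV_bool)
  have "(\<Sum>Y\<in>UNIV. overlap_weight a b Y * z ^ card Y) = 1 + 2 * a * z + b * z\<^sup>2"
    by (subst UN) (use neq in \<open>simp add: overlap_weight_def\<close>)
  then have "(1 + 2 * a * z + b * z\<^sup>2) ^ k = (\<Prod>i<k. \<Sum>Y\<in>UNIV. overlap_weight a b Y * z ^ card Y)"
    by simp
  also have "\<dots> = (\<Sum>t\<in>{..<k} \<rightarrow>\<^sub>E UNIV. \<Prod>i<k. overlap_weight a b (t i) * z ^ card (t i))"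
    by (rule prod_sum_PiE) auto
  also have "\<dots> = (\<Sum>t\<in>{..<k} \<rightarrow>\<^sub>E UNIV. (\<Prod>i<k. overlap_weight a b (t i)) * z ^ (\<Sum>i<k. card (t i)))"
    by (simp add: prod.distrib power_sum)
  finally show ?thesis ..
qed

text \<open>Bounding \<open>w choose 2\<close> by \<open>w\<^sup>2 / 2\<close> replaces the
  quadratic exponent by a \<open>w\<close>-th power, to which the generating function
  applies.\<close>

lemma power_choose_two_le:
  fixes q x :: real
  assumes "q \<ge> 1" "q powr (w / 2) \<le> x"
  shows "q ^ (w choose 2) \<le> x ^ w"
proof -
  have "real (w choose 2) \<le> w / 2 * w"
  proof -
    have "2 * (w choose 2) \<le> w * (w - 1)"
      by (simp add: choose_two)
    also have "\<dots> \<le> w * w" by simp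
    finally have "real (2 * (w choose 2)) \<le> real (w * w)"
      by (simp only: of_nat_le_iff)
    then show ?thesis by simp
  qed
  then have "q powr real (w choose 2) \<le> q powr (w / 2 * w)"
    using assms(1) by (intro powr_mono) auto
  also have "\<dots> = (q powr (w / 2)) ^ w"
    using assms(1) by (simp add: powr_powr flip: powr_realpow)
  also have "\<dots> \<le> x ^ w"
    by (intro power_mono assms) auto
  finally show ?thesis using assms(1) by (simp add: powr_realpow)
qed

text \<open>
  Overlaps with few shared vertices are summed exactly; for each larger size \<open>w\<close> the coefficient
  of \<open>z ^ w\<close> in the generating function is bounded by its value at \<open>z = w / (k * a)\<close>.
\<close>
lemma sum_overlap_le:
  fixes k :: nat and a b q Q \<beta> :: real
  assumes "k \<ge> 1" "a > 0" "b \<ge> 0" "2 * b \<le> a\<^sup>2" "q \<ge> 1" "Q \<ge> 1" "0 \<le> \<beta>" "\<beta> \<le> 1 / 2"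
    and dich: "\<And>w. 1 \<le> w \<Longrightarrow> w \<le> 2 * k \<Longrightarrow>
      q powr (w / 2) \<le> Q \<or> exp 3 * (k * a / w) * q powr (w / 2) \<le> \<beta>"
  shows "(\<Sum>t\<in>{..<k} \<rightarrow>\<^sub>E UNIV. (\<Prod>i<k. overlap_weight a b (t i)) * q ^ ((\<Sum>i<k. card (t i)) choose 2))
           \<le> (1 + 2 * a * Q + b * Q\<^sup>2) ^ k + 2 * \<beta>"
proof -
  define T :: "(nat \<Rightarrow> bool set) set" where "T = {..<k} \<rightarrow>\<^sub>E UNIV"
  define w where "w t = (\<Sum>i<k. card (t i))" for t :: "nat \<Rightarrow> bool set"
  define h where "h t = (\<Prod>i<k. overlap_weight a b (t i))" for t :: "nat \<Rightarrow> bool set"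
  define S where "S = {t \<in> T. q powr (w t / 2) \<le> Q}"
  define B where "B = {v \<in> {1..2 * k}. \<not> q powr (v / 2) \<le> Q}"
  have finT: "finite T" by (auto simp: T_def intro!: finite_PiE)
  have h: "h t \<ge> 0" for t
    unfolding h_def using assms by (intro prod_nonneg) (auto simp: overlap_weight_def)
  have gen: "(\<Sum>t\<in>T. h t * z ^ w t) = (1 + 2 * a * z + b * z\<^sup>2) ^ k" for z
    unfolding T_def h_def w_def by (rule sum_prod_overlap_weight)
  have small: "(\<Sum>t\<in>S. h t * q ^ (w t choose 2)) \<le> (1 + 2 * a * Q + b * Q\<^sup>2) ^ k"
  proof -
    have "(\<Sum>t\<in>S. h t * q ^ (w t choose 2)) \<le> (\<Sum>t\<in>S. h t * Q ^ w t)"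
      using assms h by (intro sum_mono mult_left_mono power_choose_two_le) (auto simp: S_def)
    also have "\<dots> \<le> (\<Sum>t\<in>T. h t * Q ^ w t)"
      using finT h assms by (intro sum_mono2) (auto simp: S_def)
    finally show ?thesis by (simp add: gen)
  qed
  have large: "(\<Sum>t\<in>{t \<in> T. w t = v}. h t * q ^ (w t choose 2)) \<le> \<beta> ^ v" if v: "v \<in> B" for v
  proof -
    \<comment> \<open>This choice nearly minimises \<open>exp (2 * k * a * z) / z ^ v\<close>. The
      linear term of the exponent becomes \<open>2 * v\<close>, and
      \<open>2 * b \<le> a\<^sup>2\<close> with \<open>v \<le> 2 * k\<close> keeps the quadratic one
      below \<open>v\<close>, whence the constant \<open>exp 3\<close>.\<close>
    define z where "z = v / (k * a)"
    have v': "1 \<le> v" "v \<le> 2 * k" using v by (auto simp: B_def)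
    then have z: "z > 0" using assms by (simp add: z_def)
    have "z ^ v * (\<Sum>t\<in>{t \<in> T. w t = v}. h t) = (\<Sum>t\<in>{t \<in> T. w t = v}. h t * z ^ w t)"
      by (simp add: sum_distrib_left mult.commute)
    also have "\<dots> \<le> (\<Sum>t\<in>T. h t * z ^ w t)"
      using finT h z by (intro sum_mono2) auto
    also have "\<dots> = (1 + 2 * a * z + b * z\<^sup>2) ^ k"
      by (rule gen)
    also have "\<dots> \<le> exp (2 * a * z + b * z\<^sup>2) ^ k"
      using assms z exp_ge_add_one_self[of "2 * a * z + b * z\<^sup>2"] by (intro power_mono) (auto simp: add.assoc)
    also have "\<dots> = exp (k * (2 * a * z + b * z\<^sup>2))"
      by (simp add: exp_of_nat_mult)
    also have "\<dots> \<le> exp (3 * v)"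
    proof -
      have "k * (2 * a * z) = 2 * v" using assms by (simp add: z_def)
      moreover have "k * (b * z\<^sup>2) \<le> v"
      proof -
        have "k * (b * z\<^sup>2) = b * v * v / (k * a\<^sup>2)"
          using assms by (simp add: z_def power2_eq_square field_simps)
        also have "\<dots> \<le> b * v * (2 * k) / (k * a\<^sup>2)"
          using assms v' by (intro divide_right_mono mult_left_mono) auto
        also have "\<dots> = (2 * b) / a\<^sup>2 * v"
          using assms by (simp add: field_simps)
        also have "\<dots> \<le> 1 * real v"
          using assms by (intro mult_right_mono) auto
        finally show ?thesis by simp
      qed
      ultimately show ?thesis by (simp add: distrib_left)
    qed
    also have "\<dots> = exp 3 ^ v"
      by (simp add: exp_of_nat_mult[symmetric] mult.commute)
    finally have "(\<Sum>t\<in>{t \<in> T. w t = v}. h t) \<le> (exp 3 / z) ^ v"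
      using z by (simp add: power_divide field_simps)
    then have "(\<Sum>t\<in>{t \<in> T. w t = v}. h t) * q ^ (v choose 2) \<le> (exp 3 / z) ^ v * (q powr (v / 2)) ^ v"
      using assms h z by (intro mult_mono power_choose_two_le) (auto intro: sum_nonneg)
    also have "\<dots> = (exp 3 * (k * a / v) * q powr (v / 2)) ^ v"
    proof -
      have "exp 3 / z = exp 3 * (k * a / v)" by (simp add: z_def)
      then show ?thesis by (simp only: power_mult_distrib)
    qed
    also have "\<dots> \<le> \<beta> ^ v"
      using dich[OF v'] v assms by (intro power_mono) (auto simp: B_def)
    finally show ?thesis
      by (simp add: sum_distrib_right)
  qed
  have "(\<Sum>t\<in>T. h t * q ^ (w t choose 2)) =
      (\<Sum>t\<in>S. h t * q ^ (w t choose 2)) + (\<Sum>t\<in>T - S. h t * q ^ (w t choose 2))"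
    using finT by (subst sum.subset_diff[of S T]) (auto simp: S_def)
  also have "(\<Sum>t\<in>T - S. h t * q ^ (w t choose 2)) =
      (\<Sum>v\<in>B. \<Sum>t\<in>{t \<in> T - S. w t = v}. h t * q ^ (w t choose 2))"
  proof (rule sum.group[symmetric])
    have "w t \<in> B" if "t \<in> T - S" for t
    proof -
      have "card (t i) \<le> 2" for i
        using card_mono[of "UNIV :: bool set" "t i"] by simp
      then have "w t \<le> 2 * k"
        using sum_mono[of "{..<k}" "\<lambda>i. card (t i)" "\<lambda>_. 2"] by (simp add: w_def)
      moreover have "\<not> q powr (w t / 2) \<le> Q" using that by (auto simp: S_def)
      \<comment> \<open>Disjoint placements give \<open>q powr 0 = 1 \<le> Q\<close> and hence
        always belong to \<open>S\<close>.\<close>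
      moreover have "w t \<noteq> 0"
        using calculation(2) assms(5,6) by (intro notI) simp
      ultimately show ?thesis by (auto simp: B_def)
    qed
    then show "w ` (T - S) \<subseteq> B" by auto
  qed (use finT in \<open>auto simp: B_def\<close>)
  also have "\<dots> \<le> (\<Sum>v\<in>B. \<beta> ^ v)"
  proof (intro sum_mono)
    fix v assume v: "v \<in> B"
    have "{t \<in> T - S. w t = v} = {t \<in> T. w t = v}"
      using v by (auto simp: S_def B_def)
    then show "(\<Sum>t\<in>{t \<in> T - S. w t = v}. h t * q ^ (w t choose 2)) \<le> \<beta> ^ v"
      using large[OF v] by simp
  qed
  also have "\<dots> \<le> (\<Sum>v\<in>{1..<Suc (2 * k)}. \<beta> ^ v)"
    using assms by (intro sum_mono2) (auto simp: B_def)
  also have "\<dots> \<le> 2 * \<beta>"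
  proof -
    have eq: "(\<Sum>v\<in>{1..<Suc (2 * k)}. \<beta> ^ v) = \<beta> * (\<Sum>v<2 * k. \<beta> ^ v)"
      by (simp only: One_nat_def sum.shift_bounds_Suc_ivl power_Suc sum_distrib_left lessThan_atLeast0)
    have "(\<Sum>v<2 * k. \<beta> ^ v) \<le> (\<Sum>v. \<beta> ^ v)"
      using assms by (intro sum_le_suminf summable_geometric) auto
    also have "\<dots> = 1 / (1 - \<beta>)"
      using assms by (intro suminf_geometric) auto
    also have "\<dots> \<le> 2"
      using assms by (simp add: field_simps)
    finally have "\<beta> * (\<Sum>v<2 * k. \<beta> ^ v) \<le> \<beta> * 2"
      using assms by (intro mult_left_mono)
    then show ?thesis unfolding eq by (simp only: mult.commute)
  qed
  finally show ?thesis
    using small by (simp add: T_def h_def w_def)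
qed


text \<open>
  With argument \<open>m = n p\<close>, these are the \<open>\<eta>\<close> and \<open>\<beta>\<close> of the introduction. Overlaps of \<open>w\<close> vertices
  count as small if \<open>w \<le> 2 k m\<^bsup>-3/4\<^esup>\<close>; the two summands of \<open>large_overlap\<close> come from
  \<open>w \<le> k / 4\<close> and \<open>w > k / 4\<close>.
\<close>
definition variance_exponent :: "real \<Rightarrow> real" where
  "variance_exponent x =
     exp (ln x * x powr (-3/4)) / (1 - 2 * ln x / x)\<^sup>2 - 1 +
     exp (2 * ln x * x powr (-3/4)) / (2 * x * (1 - 2 * ln x / x) ^ 4)"

definition large_overlap :: "real \<Rightarrow> real \<Rightarrow> real" where
  "large_overlap \<delta> x =
     2 * exp 3 * ln x * x powr (-1/8) + 16 * exp 3 * ln x * x powr (-\<delta>)"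

text \<open>For an overlap of \<open>w = 2 * k * y\<close> vertices, the bound on
  \<open>q powr k\<close> gives \<open>q powr (w / 2) \<le> m powr ((1 - \<delta>) * y)\<close>,
  while \<open>k * a / w\<close> is of order at most \<open>ln m / (m * y)\<close>. The first is
  close to 1 for tiny \<open>y\<close>; for larger \<open>y\<close> the product of the two is
  small.\<close>

lemma prob_induced_matching_ge_explicit:
  fixes p \<delta> :: real and k n :: nat
  assumes p: "0 < p" "p < 1" and k: "k \<ge> 1" "1 \<le> k * p" "k * p \<le> ln (n * p)"
    and \<delta>: "0 < \<delta>" "\<delta> < 1" and qk: "(1 / (1 - p)) powr k \<le> (n * p) powr (1 - \<delta>)"
    and m1: "n * p > 1" "8 * ln (n * p) \<le> n * p" "large_overlap \<delta> (n * p) \<le> 1 / 2"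
  shows "1 \<le> measure_pmf.prob (gnp n p) {E. k \<le> induced_matching_number E} *
           (exp (4 * k\<^sup>2 / n * variance_exponent (n * p)) + 2 * large_overlap \<delta> (n * p))"
proof -
  define m L q where "m = n * p" and "L = ln m" and "q = 1 / (1 - p)"
  define \<rho> where "\<rho> = (real n - 2 * real k) / n"
  define x where "x = n / (real n - 2 * real k)\<^sup>2"
  define a b where "a = real (2 * k) * x" and "b = real (2 * k) * (1 / p) * x\<^sup>2"
  \<comment> \<open>\<open>Q\<close> equals \<open>m powr y\<close> at the threshold
    \<open>y = m powr (-3/4)\<close>.\<close>
  define Q where "Q = exp (L * m powr (-3/4))"
  define \<beta> where "\<beta> = large_overlap \<delta> m"
  \<comment> \<open>A lower bound for \<open>\<rho>\<close> in terms of \<open>m\<close> alone,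
    valid because \<open>k / n \<le> L / m\<close>.\<close>
  define r where "r = 1 - 2 * (L / m)"
  have m: "m > 1" "8 * L \<le> m" "L > 0"
    using m1 by (simp_all add: m_def L_def)
  have n: "n > 0" using m1(1) p by (cases n) auto
  have q: "q > 1" using p by (simp add: q_def field_simps)
  have kn: "k / n \<le> L / m"
    using k(3) n p by (simp add: m_def L_def field_simps)
  have "L / m \<le> 1 / 8" using m by (simp add: field_simps)
  then have "k / n \<le> 1 / 8" using kn by linarith
  then have kn8: "8 * real k \<le> n" using n by (simp add: field_simps)
  then have k4: "4 * k \<le> n" by linarith
  have \<rho>: "\<rho> = 1 - 2 * (k / n)" using n by (simp add: \<rho>_def field_simps)
  have r: "r \<le> \<rho>" "r \<ge> 3 / 4"
    unfolding \<rho> r_def using kn \<open>L / m \<le> 1 / 8\<close> by linarith+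
  have x: "x = 1 / (n * \<rho>\<^sup>2)"
  proof -
    have "n * \<rho>\<^sup>2 = (real n - 2 * real k)\<^sup>2 / n"
      using n by (simp add: \<rho>_def power_divide power2_eq_square)
    then show ?thesis by (simp add: x_def)
  qed
  have "x > 0" using n r by (auto simp: x)
  then have a: "a > 0" and b: "b \<ge> 0" using k(1) p by (simp_all add: a_def b_def)
  \<comment> \<open>The hypothesis \<open>1 \<le> k * p\<close> enters here:
    \<open>2 * b / a\<^sup>2\<close> equals \<open>1 / (k * p)\<close>.\<close>
  have ab: "2 * b \<le> a\<^sup>2"
  proof -
    have "2 * b = 4 * k * x\<^sup>2 / p" by (simp add: b_def)
    also have "\<dots> \<le> 4 * k * x\<^sup>2 * k"
      using k(2) p mult_left_mono[OF k(2), of "4 * k * x\<^sup>2"] by (simp add: field_simps)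
    finally show ?thesis by (simp add: a_def power2_eq_square)
  qed
  have Q: "Q \<ge> 1" using m by (simp add: Q_def)
  have \<beta>: "0 \<le> \<beta>" "\<beta> \<le> 1 / 2"
    using m m1(3) by (simp_all add: \<beta>_def large_overlap_def m_def L_def)
  have qk': "q powr (y * k) \<le> m powr ((1 - \<delta>) * y)" if "y \<ge> 0" for y :: real
    using powr_mono2[OF that powr_ge_zero qk] by (simp add: powr_powr q_def m_def mult.commute)
  have dich: "q powr (w / 2) \<le> Q \<or> exp 3 * (k * a / w) * q powr (w / 2) \<le> \<beta>"
    if w: "1 \<le> w" "w \<le> 2 * k" for w :: nat
  proof -
    define y where "y = w / (2 * k)"
    have y: "0 < y" "y \<le> 1" and yw: "y * k = w / 2"
      using w k(1) by (simp_all add: y_def field_simps)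
    have qw: "q powr (w / 2) \<le> m powr ((1 - \<delta>) * y)"
      using qk'[of y] y yw by simp
    have \<delta>y: "(1 - \<delta>) * y \<le> y"
      using \<delta> y mult_right_mono[of "1 - \<delta>" 1 y] by simp
    have \<delta>y1: "(1 - \<delta>) * y \<le> 1 - \<delta>"
      using \<delta> y mult_left_mono[of y 1 "1 - \<delta>"] by simp
    show ?thesis
    proof (cases "y \<le> m powr (-3/4)")
      case True
      have "m powr ((1 - \<delta>) * y) \<le> m powr (m powr (-3/4))"
        using True \<delta>y m by (intro powr_mono) auto
      also have "\<dots> = Q"
        using m by (simp add: Q_def L_def powr_def mult.commute)
      finally show ?thesis using qw by simp
    next
      case False
      have "k * a / w = k / n / (\<rho>\<^sup>2 * y)"
        using w k(1) n by (simp add: a_def x y_def field_simps)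
      also have "\<dots> \<le> (L / m) / (1 / 2 * y)"
      proof (rule frac_le[OF _ kn])
        have "(3 / 4) ^ 2 \<le> \<rho>\<^sup>2" using r by (intro power_mono) auto
        then show "1 / 2 * y \<le> \<rho>\<^sup>2 * y"
          using y by (intro mult_right_mono) (auto simp: power2_eq_square)
      qed (use y m in auto)
      finally have "k * a / w \<le> 2 * (L / m) / y" by (simp add: mult.commute)
      then have "exp 3 * (k * a / w) * q powr (w / 2) \<le> exp 3 * (2 * (L / m) / y) * m powr ((1 - \<delta>) * y)"
        using qw y m a by (intro mult_mono) auto
      also have "\<dots> = 2 * exp 3 * L * (m powr (-1) * (1 / y) * m powr ((1 - \<delta>) * y))"
        using m by (simp add: powr_minus field_simps)
      \<comment> \<open>For \<open>y \<le> 1 / 8\<close> the exponents of \<open>m\<close> add up to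
        -1 + 3/4 + 1/8 = -1/8. For larger \<open>y\<close> the factor \<open>1 / y\<close> is at
        most 8 and the exponents add up to \<open>-\<delta>\<close>.\<close>
      also have "\<dots> \<le> \<beta>"
      proof (cases "y \<le> 1 / 8")
        case True
        have "1 / y \<le> m powr (3/4)"
          using False y m by (simp add: powr_minus field_simps)
        moreover have "m powr ((1 - \<delta>) * y) \<le> m powr (1/8)"
          using True \<delta>y m by (intro powr_mono) auto
        ultimately have "m powr (-1) * (1 / y) * m powr ((1 - \<delta>) * y) \<le>
            m powr (-1) * m powr (3/4) * m powr (1/8)"
          using y by (intro mult_mono mult_left_mono mult_nonneg_nonneg) auto
        also have "\<dots> = m powr (-1/8)"
          unfolding powr_add[symmetric] by simp
        finally have "2 * exp 3 * L * (m powr (-1) * (1 / y) * m powr ((1 - \<delta>) * y)) \<le> 2 * exp 3 * L * m powr (-1/8)"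
          using m by (intro mult_left_mono) auto
        also have "\<dots> \<le> \<beta>"
          using m by (simp add: \<beta>_def large_overlap_def L_def)
        finally show ?thesis .
      next
        case False
        have "1 / y \<le> 8" using False y by (simp add: field_simps)
        moreover have "m powr ((1 - \<delta>) * y) \<le> m powr (1 - \<delta>)"
          using \<delta>y1 m by (intro powr_mono) auto
        ultimately have "m powr (-1) * (1 / y) * m powr ((1 - \<delta>) * y) \<le>
            m powr (-1) * 8 * m powr (1 - \<delta>)"
          using y by (intro mult_mono mult_left_mono mult_nonneg_nonneg) auto
        also have "\<dots> = 8 * (m powr (-1) * m powr (1 - \<delta>))"
          by (simp only: ac_simps)
        also have "\<dots> = 8 * m powr (-\<delta>)"
          unfolding powr_add[symmetric] by simp
        finally have "2 * exp 3 * L * (m powr (-1) * (1 / y) * m powr ((1 - \<delta>) * y)) \<le> 2 * exp 3 * L * (8 * m powr (-\<delta>))"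
          using m by (intro mult_left_mono) auto
        also have "\<dots> \<le> \<beta>"
          using m by (simp add: \<beta>_def large_overlap_def L_def)
        finally show ?thesis .
      qed
      finally show ?thesis ..
    qed
  qed
  let ?S = "\<Sum>t\<in>{..<k} \<rightarrow>\<^sub>E UNIV. (\<Prod>i<k. overlap_weight a b (t i)) * q ^ ((\<Sum>i<k. card (t i)) choose 2)"
  have S: "?S \<le> (1 + 2 * a * Q + b * Q\<^sup>2) ^ k + 2 * \<beta>"
    using q Q by (intro sum_overlap_le k(1) a b ab \<beta> dich) auto
  have "\<rho> \<le> 1" by (simp add: \<rho>)
  have "\<rho> ^ (2 * k) * ?S \<le> \<rho> ^ (2 * k) * (1 + 2 * a * Q + b * Q\<^sup>2) ^ k + \<rho> ^ (2 * k) * (2 * \<beta>)"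
    using mult_left_mono[OF S, of "\<rho> ^ (2 * k)"] r by (simp add: distrib_left)
  also have "\<rho> ^ (2 * k) * (2 * \<beta>) \<le> 1 * (2 * \<beta>)"
    using r \<beta> \<open>\<rho> \<le> 1\<close> by (intro mult_right_mono power_le_one) auto
  \<comment> \<open>The decisive cancellation: \<open>\<rho> ^ (2 * k)\<close> is at most
    \<open>exp (- 4 * k\<^sup>2 / n)\<close>, which offsets the leading part of
    \<open>2 * k * a * Q\<close>, namely \<open>4 * k\<^sup>2 / n\<close>. This is the
    \<open>- 1\<close> in \<open>variance_exponent\<close>.\<close>
  also have "\<rho> ^ (2 * k) * (1 + 2 * a * Q + b * Q\<^sup>2) ^ k \<le> exp (4 * k\<^sup>2 / n * variance_exponent m)"
  proof -
    have "\<rho> ^ (2 * k) * (1 + 2 * a * Q + b * Q\<^sup>2) ^ k \<le> exp (- 2 * (k / n)) ^ (2 * k) * exp (2 * a * Q + b * Q\<^sup>2) ^ k"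
      using r a b Q exp_ge_add_one_self[of "- 2 * (k / n)"] exp_ge_add_one_self[of "2 * a * Q + b * Q\<^sup>2"]
      by (intro mult_mono power_mono) (auto simp: \<rho> add.assoc)
    also have "\<dots> = exp (real (2 * k) * (- 2 * (k / n)) + k * (2 * a * Q + b * Q\<^sup>2))"
      by (simp only: exp_of_nat_mult exp_add)
    also have "real (2 * k) * (- 2 * (k / n)) + k * (2 * a * Q + b * Q\<^sup>2) =
        4 * k\<^sup>2 / n * (Q * (1 / \<rho>\<^sup>2) - 1 + Q\<^sup>2 / (2 * m) * (1 / \<rho> ^ 4))"
      using n p r by (simp add: a_def b_def x m_def field_simps power2_eq_square power4_eq_xxxx)
    also have "exp \<dots> \<le> exp (4 * k\<^sup>2 / n * (Q * (1 / r\<^sup>2) - 1 + Q\<^sup>2 / (2 * m) * (1 / r ^ 4)))"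
    proof -
      have "1 / \<rho>\<^sup>2 \<le> 1 / r\<^sup>2" "1 / \<rho> ^ 4 \<le> 1 / r ^ 4"
        using r by (auto intro!: divide_left_mono power_mono mult_pos_pos)
      then show ?thesis
        using Q m by (subst exp_le_cancel_iff, intro mult_left_mono add_mono diff_mono) auto
    qed
    also have "Q * (1 / r\<^sup>2) - 1 + Q\<^sup>2 / (2 * m) * (1 / r ^ 4) = variance_exponent m"
      by (simp add: variance_exponent_def Q_def r_def L_def exp_double[symmetric] mult.assoc)
    finally show ?thesis .
  qed
  finally have "\<rho> ^ (2 * k) * ?S \<le> exp (4 * k\<^sup>2 / n * variance_exponent m) + 2 * \<beta>"
    by simp
  moreover have "1 \<le> measure_pmf.prob (gnp n p) {E. k \<le> induced_matching_number E} * (\<rho> ^ (2 * k) * ?S)"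
    using prob_induced_matching_ge[OF p k4 n] by (simp only: \<rho>_def a_def b_def x_def q_def)
  ultimately show ?thesis
    by (smt (verit) \<beta>_def m_def measure_nonneg mult_left_mono)
qed

section \<open>The first moment\<close>

text \<open>The left side divided by \<open>fact k\<close> is a single term of the series for
  \<open>exp k\<close>.\<close>

lemma power_self_le_fact: "real k ^ k \<le> exp k * fact k"
proof -
  have "(\<lambda>n. real k ^ n / fact n) sums exp k"
    using exp_converges[of "real k"] by (simp add: divide_inverse mult.commute)
  then have "(\<Sum>n\<in>{k}. real k ^ n / fact n) \<le> exp (real k)"
    unfolding sums_iff by (metis (no_types, lifting) sum_le_suminf finite.intros divide_nonneg_nonneg fact_ge_zero of_nat_0_le_iff zero_le_power)
  then show ?thesis by (simp add: field_simps)
qed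

text \<open>A union bound over matchings with exactly \<open>k\<close> edges, which suffice because
  subsets of induced matchings are induced. Each leaves \<open>2 * k * (k - 1)\<close> pairs that
  must be non-edges. In counting the matchings, disjointness is dropped.\<close>

lemma prob_induced_matching_le:
  fixes p :: real and k n :: nat
  assumes p: "0 \<le> p" "p \<le> 1"
  shows "measure_pmf.prob (gnp n p) {E. k \<le> induced_matching_number E} \<le>
           (real n ^ 2 * p / 2) ^ k / fact k * (1 - p) ^ (2 * k * (k - 1))"
proof -
  define \<M> where "\<M> = {M. M \<subseteq> vertex_pairs n \<and> card M = k \<and> pairwise disjnt M}"
  define A where "A M = {E. E \<inter> pairs_in (\<Union>M) = M}" for M :: "nat set set"
  let ?prob = "measure_pmf.prob (gnp n p)"
  have fin: "finite \<M>"
    by (rule finite_subset[of _ "Pow (vertex_pairs n)"]) (auto simp: \<M>_def finite_vertex_pairs)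
  have "{E. k \<le> induced_matching_number E} \<inter> set_pmf (gnp n p) \<subseteq> (\<Union>M\<in>\<M>. A M)"
  proof clarify
    fix E assume k: "k \<le> induced_matching_number E" and "E \<in> set_pmf (gnp n p)"
    then have E: "E \<subseteq> vertex_pairs n" by (simp add: set_pmf_gnp_subset)
    obtain M where M: "induced_matching E M" "card M = induced_matching_number E"
      using induced_matching_number_attained(1)[OF E] by blast
    obtain M' where M': "M' \<subseteq> M" "card M' = k"
      using obtain_subset_with_card_n[of k M] k M(2) by metis
    have "{} \<notin> E" using E by (auto simp: mem_vertex_pairs)
    then have ind: "induced_matching E M'"
      by (rule induced_matching_subset[OF M(1) M'(1)])
    then have "M' \<subseteq> E" "pairwise disjnt M'" by (simp_all add: induced_matching_def)
    then have "M' \<in> \<M>" using E M'(2) by (auto simp: \<M>_def)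
    moreover have "E \<in> A M'"
      using ind by (simp add: A_def induced_matching_def induced_edges_vertex_pairs[OF E] pairs_in_def)
    ultimately show "E \<in> (\<Union>M\<in>\<M>. A M)" by blast
  qed
  then have "?prob ({E. k \<le> induced_matching_number E} \<inter> set_pmf (gnp n p)) \<le> ?prob (\<Union>M\<in>\<M>. A M)"
    by (intro measure_pmf.finite_measure_mono) auto
  also have "\<dots> \<le> (\<Sum>M\<in>\<M>. ?prob (A M))"
    by (intro measure_pmf.finite_measure_subadditive_finite fin) auto
  also have "\<dots> = (\<Sum>M\<in>\<M>. p ^ k * (1 - p) ^ (2 * k * (k - 1)))"
  proof (intro sum.cong refl)
    fix M assume "M \<in> \<M>"
    then have M: "M \<subseteq> vertex_pairs n" "card M = k" "pairwise disjnt M" by (auto simp: \<M>_def)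
    then have finM: "finite M" by (auto intro: finite_subset finite_vertex_pairs)
    have e: "finite e" "card e = 2" if "e \<in> M" for e
      using M(1) that by (auto simp: mem_vertex_pairs intro!: card_ge_0_finite)
    have U: "card (\<Union>M) = 2 * k"
      using card_Union_disjoint[OF M(3)] e M(2) by simp
    have sub: "M \<subseteq> pairs_in (\<Union>M)" using e by (auto simp: pairs_in_def)
    have "pairs_in (\<Union>M) \<subseteq> vertex_pairs n"
      using M(1) by (fastforce simp: pairs_in_def mem_vertex_pairs)
    then have "?prob (A M) = p ^ card M * (1 - p) ^ card (pairs_in (\<Union>M) - M)"
      unfolding A_def using p sub by (intro prob_gnp_Int_eq)
    also have "card (pairs_in (\<Union>M) - M) = (2 * k choose 2) - k"
      using sub finM e M(2) U by (simp add: card_Diff_subset card_pairs_in)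
    also have "(2 * k choose 2) - k = 2 * k * (k - 1)"
      by (cases k) (simp_all add: choose_two)
    finally show "?prob (A M) = p ^ k * (1 - p) ^ (2 * k * (k - 1))" by (simp add: M(2))
  qed
  also have "\<dots> = real (card \<M>) * (p ^ k * (1 - p) ^ (2 * k * (k - 1)))"
    by simp
  also have "\<dots> \<le> ((real n ^ 2 / 2) ^ k / fact k) * (p ^ k * (1 - p) ^ (2 * k * (k - 1)))"
  proof (rule mult_right_mono)
    have "card \<M> \<le> (n choose 2) choose k"
      using n_subsets[OF finite_vertex_pairs[of n], of k] card_mono[of "{M. M \<subseteq> vertex_pairs n \<and> card M = k}" \<M>]
      by (auto simp: \<M>_def card_vertex_pairs finite_vertex_pairs)
    then have "card \<M> * fact k \<le> ((n choose 2) choose k) * fact k"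
      by (rule mult_right_mono) simp
    also have "\<dots> \<le> (n choose 2) ^ k"
      by (rule binomial_fact_pow)
    finally have "real (card \<M> * fact k) \<le> real ((n choose 2) ^ k)"
      by (simp only: of_nat_le_iff)
    also have "\<dots> \<le> (real n ^ 2 / 2) ^ k"
    proof -
      have "2 * (n choose 2) \<le> n * (n - 1)" by (simp add: choose_two)
      also have "\<dots> \<le> n * n" by simp
      finally have "real (2 * (n choose 2)) \<le> real (n * n)" by (simp only: of_nat_le_iff)
      then show ?thesis by (simp add: power_mono power2_eq_square)
    qed
    finally show "real (card \<M>) \<le> (real n ^ 2 / 2) ^ k / fact k"
      by (simp add: field_simps)
  qed (use p in auto)
  also have "\<dots> = (real n ^ 2 * p / 2) ^ k / fact k * (1 - p) ^ (2 * k * (k - 1))"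
    by (simp add: power_mult_distrib power_divide)
  finally show ?thesis by (simp add: measure_Int_set_pmf)
qed

section \<open>Size of the logarithm and the explicit upper tail\<close>

lemma ln_inverse_one_minus_bounds:
  fixes p :: real
  assumes "0 < p" "p \<le> 0.99"
  shows "p \<le> ln (1 / (1 - p))" "ln (1 / (1 - p)) \<le> 100 * p"
proof -
  have "ln (1 - p) \<le> - p"
    using ln_le_minus_one[of "1 - p"] assms by simp
  then show "p \<le> ln (1 / (1 - p))" using assms by (simp add: ln_div)
  have "ln (1 / (1 - p)) \<le> 1 / (1 - p) - 1"
    using assms by (intro ln_le_minus_one) auto
  also have "\<dots> = p / (1 - p)" using assms by (simp add: field_simps)
  \<comment> \<open>The bound \<open>p \<le> 0.99\<close> keeps \<open>1 - p\<close> at least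
    \<open>0.01\<close>, so \<open>ln (1 / (1 - p))\<close> is within a constant factor of
    \<open>p\<close>.\<close>
  also have "\<dots> \<le> p / 0.01" using assms by (intro divide_left_mono) auto
  finally show "ln (1 / (1 - p)) \<le> 100 * p" by simp
qed

lemma log_inverse_one_minus_bounds:
  fixes p x :: real
  assumes p: "0 < p" "p \<le> 0.99" and "x > 1"
  shows "ln x / (100 * p) \<le> log (1 / (1 - p)) x" "log (1 / (1 - p)) x \<le> ln x / p"
  unfolding log_def using ln_inverse_one_minus_bounds[OF p] assms
  by (auto intro!: divide_left_mono mult_pos_pos intro: less_le_trans)

text \<open>As \<open>ln x / x\<close> decreases beyond \<open>exp 1\<close> and
  \<open>n * p \<le> n\<close>, the logarithm grows with \<open>n\<close> uniformly in
  \<open>p\<close>. This makes error bounds depend on \<open>n\<close> only.\<close>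

lemma log_ge_ln_card:
  fixes p :: real and n :: nat
  assumes p: "0 < p" "p \<le> 0.99" and np: "n * p \<ge> exp 1"
  shows "ln n / 100 \<le> log (1 / (1 - p)) (n * p)"
proof -
  have n: "n > 0" using np by (cases n) (auto simp: not_le)
  have "ln n / n \<le> ln (n * p) / (n * p)"
    using p n by (intro ln_x_over_x_mono np) auto
  then have "ln n / 100 \<le> ln (n * p) / (100 * p)"
    using n p by (simp add: field_simps)
  also have "\<dots> \<le> log (1 / (1 - p)) (n * p)"
    using np by (intro log_inverse_one_minus_bounds p less_le_trans[OF _ np]) auto
  finally show ?thesis .
qed

text \<open>The first moment is at most a \<open>k\<close>-th power. In its base
  \<open>n\<^sup>2 * p / k\<close> is at most \<open>100 * m\<^sup>2 / ln m\<close>, and the choice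
  of \<open>k\<close> makes \<open>(1 - p) ^ (2 * k)\<close> at most
  \<open>m powr (- 2 - 2 * \<epsilon>)\<close>, so a negative power of \<open>m\<close>
  remains.\<close>

lemma prob_induced_matching_le_explicit:
  fixes p \<epsilon> :: real and k n :: nat
  assumes p: "0 < p" "p \<le> 0.99" and "\<epsilon> > 0" and m: "n * p > 1"
    and small: "500000 * exp 1 * (n * p) powr (- 2 * \<epsilon>) / ln (n * p) \<le> 1 / 2"
    and k: "k \<ge> 1" "(1 + \<epsilon>) * log (1 / (1 - p)) (n * p) \<le> k"
  shows "measure_pmf.prob (gnp n p) {E. k \<le> induced_matching_number E} \<le> (1 / 2) ^ k"
proof -
  define m L q where "m = n * p" and "L = ln m" and "q = 1 / (1 - p)"
  have q: "q > 1" using p by (simp add: q_def field_simps)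
  have m: "m > 1" and L: "L > 0" using m by (simp_all add: m_def L_def)
  have lg: "log q m > 0" using q m by simp
  have "1 * log q m \<le> (1 + \<epsilon>) * log q m"
    using lg \<open>\<epsilon> > 0\<close> by (intro mult_right_mono) auto
  then have "L / (100 * p) \<le> k"
    using log_inverse_one_minus_bounds(1)[OF p m] k(2) by (simp add: q_def m_def L_def)
  then have kL: "n\<^sup>2 * p / k \<le> 100 * m\<^sup>2 / L"
    using p k(1) L mult_right_mono[of L "100 * p * k" "n\<^sup>2 * p"]
    by (simp add: m_def field_simps power2_eq_square)
  have "m powr (2 + 2 * \<epsilon>) = (q powr log q m) powr (2 * (1 + \<epsilon>))"
    using q m by (simp add: algebra_simps)
  also have "\<dots> = q powr (2 * ((1 + \<epsilon>) * log q m))"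
    by (simp add: powr_powr algebra_simps)
  also have "\<dots> \<le> q powr (2 * k)"
    using q k(2) by (intro powr_mono) (auto simp: q_def m_def)
  also have "\<dots> = q ^ (2 * k)"
    using q by (simp flip: powr_realpow)
  finally have "(1 - p) ^ (2 * k) \<le> 1 / m powr (2 + 2 * \<epsilon>)"
    using m p by (simp add: q_def field_simps power_divide)
  then have "(1 - p) ^ (2 * k) \<le> m powr (- 2 - 2 * \<epsilon>)"
    by (simp add: powr_minus[symmetric] inverse_eq_divide[symmetric])
  moreover have "(1 - p) ^ (2 * (k - 1)) * (1 - p)\<^sup>2 = (1 - p) ^ (2 * k)"
    using k(1) by (cases k) (simp_all add: power2_eq_square)
  \<comment> \<open>Passing from exponent \<open>2 * k\<close> to \<open>2 * (k - 1)\<close> costs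
    two factors \<open>1 - p \<ge> 0.01\<close>, hence the 10000; together with 100 and 1/2 it
    yields 500000.\<close>
  moreover have "(1 - p) ^ (2 * (k - 1)) * (0.01)\<^sup>2 \<le> (1 - p) ^ (2 * (k - 1)) * (1 - p)\<^sup>2"
    using p by (intro mult_left_mono power_mono) auto
  ultimately have qk: "(1 - p) ^ (2 * (k - 1)) \<le> 10000 * m powr (- 2 - 2 * \<epsilon>)"
    by (simp add: power2_eq_square)
  have "measure_pmf.prob (gnp n p) {E. k \<le> induced_matching_number E} \<le>
      (real n ^ 2 * p / 2) ^ k / fact k * (1 - p) ^ (2 * k * (k - 1))"
    using p by (intro prob_induced_matching_le) auto
  also have "\<dots> \<le> (real n ^ 2 * p / 2) ^ k * (exp 1 / k) ^ k * (1 - p) ^ (2 * k * (k - 1))"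
  proof -
    have "1 / fact k \<le> exp k / real k ^ k"
      using power_self_le_fact[of k] k(1) by (simp add: field_simps)
    also have "exp k = exp 1 ^ k" by (simp flip: exp_of_nat_mult)
    finally have "1 / fact k \<le> (exp 1 / real k) ^ k" by (simp add: power_divide)
    from mult_left_mono[OF this, of "(real n ^ 2 * p / 2) ^ k"] show ?thesis
      using p by (intro mult_right_mono) auto
  qed
  also have "\<dots> = (exp 1 / 2 * (n\<^sup>2 * p / k) * (1 - p) ^ (2 * (k - 1))) ^ k"
  proof -
    have "(1 - p) ^ (2 * k * (k - 1)) = ((1 - p) ^ (2 * (k - 1))) ^ k"
      unfolding power_mult[symmetric] by (simp only: ac_simps)
    then show ?thesis
      by (simp only: power_mult_distrib[symmetric]) (simp add: ac_simps)
  qed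
  also have "\<dots> \<le> (1 / 2) ^ k"
  proof (rule power_mono)
    have "exp 1 / 2 * (n\<^sup>2 * p / k) * (1 - p) ^ (2 * (k - 1)) \<le>
        exp 1 / 2 * (100 * m\<^sup>2 / L) * (10000 * m powr (- 2 - 2 * \<epsilon>))"
      using p L by (intro mult_mono kL qk) auto
    also have "\<dots> = 500000 * exp 1 * (m powr 2 * m powr (- 2 - 2 * \<epsilon>)) / L"
      using m by simp
    also have "m powr 2 * m powr (- 2 - 2 * \<epsilon>) = m powr (- 2 * \<epsilon>)"
      unfolding powr_add[symmetric] by simp
    also have "500000 * exp 1 * m powr (- 2 * \<epsilon>) / L \<le> 1 / 2"
      using small by (simp only: m_def L_def)
    finally show "exp 1 / 2 * (n\<^sup>2 * p / k) * (1 - p) ^ (2 * (k - 1)) \<le> 1 / 2" .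
  qed (use p in auto)
  finally show ?thesis .
qed

section \<open>Bounds with high probability\<close>

text \<open>\<open>C\<close> is chosen before \<open>\<theta>\<close>, and for each
  \<open>\<theta>\<close> one threshold for \<open>n\<close> serves all \<open>p\<close>; this
  uniformity allows a sequence \<open>p n\<close> to be substituted later.\<close>

lemma induced_matching_number_upper_whp:
  fixes \<epsilon> :: real
  assumes "\<epsilon> > 0"
  obtains C where "C > 0" and "\<And>\<theta>. \<theta> > 0 \<Longrightarrow> \<forall>\<^sub>F n in sequentially. \<forall>p::real. C / real n \<le> p \<and> p \<le> 0.99 \<longrightarrow>
    measure_pmf.prob (gnp n p)
      {E. (1 + \<epsilon>) * log (1 / (1 - p)) (n * p) < induced_matching_number E} \<le> \<theta>"
proof -
  have "\<forall>\<^sub>F m in at_top. 500000 * exp 1 * m powr (- 2 * \<epsilon>) / ln m \<le> (1 / 2 :: real)"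
    using assms by real_asymp
  then obtain C0 where C0: "\<And>m. m \<ge> C0 \<Longrightarrow> 500000 * exp 1 * m powr (- 2 * \<epsilon>) / ln m \<le> (1 / 2 :: real)"
    by (auto simp: eventually_at_top_linorder)
  define C where "C = max C0 (exp 1)"
  show ?thesis
  proof (rule that[of C])
    show "C > 0" by (simp add: C_def less_max_iff_disj)
    fix \<theta> :: real assume "\<theta> > 0"
    then have "\<forall>\<^sub>F n in sequentially. (1 / 2) powr (ln (real n) / 100) \<le> \<theta>"
      by real_asymp
    moreover have "\<forall>\<^sub>F n in sequentially. n > (0 :: nat)" by (rule eventually_gt_at_top)
    ultimately show "\<forall>\<^sub>F n in sequentially. \<forall>p::real. C / real n \<le> p \<and> p \<le> 0.99 \<longrightarrow>
        measure_pmf.prob (gnp n p)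
          {E. (1 + \<epsilon>) * log (1 / (1 - p)) (n * p) < induced_matching_number E} \<le> \<theta>"
    proof eventually_elim
      case (elim n)
      show ?case
      proof (intro allI impI)
        fix p :: real assume p: "C / real n \<le> p \<and> p \<le> 0.99"
        then have m: "n * p \<ge> C" using elim(2) by (simp add: field_simps)
        have "p > 0"
          using p \<open>C > 0\<close> elim(2) by (auto intro: less_le_trans[rotated])
        have m': "n * p \<ge> exp 1" "n * p \<ge> C0" using m by (auto simp: C_def)
        have "(1 :: real) < exp 1" by simp
        then have m1: "n * p > 1" using m'(1) by linarith
        let ?l = "log (1 / (1 - p)) (n * p)"
        have l: "ln n / 100 \<le> ?l" using log_ge_ln_card[OF \<open>p > 0\<close> _ m'(1)] p by simp
        have "ln n \<ge> 0" using elim(2) by simp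
        then have l0: "?l \<ge> 0" using l by linarith
        then have l1: "?l \<le> (1 + \<epsilon>) * ?l" "0 \<le> (1 + \<epsilon>) * ?l"
          using assms mult_right_mono[of 1 "1 + \<epsilon>" ?l] by simp_all
        \<comment> \<open>The least integer strictly above
          \<open>(1 + \<epsilon>) * ?l\<close>.\<close>
        define k where "k = Suc (nat \<lfloor>(1 + \<epsilon>) * ?l\<rfloor>)"
        have k: "(1 + \<epsilon>) * ?l \<le> k" using l1 by (simp add: k_def) linarith
        have "measure_pmf.prob (gnp n p) {E. (1 + \<epsilon>) * ?l < induced_matching_number E} \<le>
            measure_pmf.prob (gnp n p) {E. k \<le> induced_matching_number E}"
        proof (intro measure_pmf.finite_measure_mono subsetI)
          fix E assume "E \<in> {E. (1 + \<epsilon>) * ?l < induced_matching_number E}"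
          then have "(1 + \<epsilon>) * ?l < induced_matching_number E" by simp
          then have "nat \<lfloor>(1 + \<epsilon>) * ?l\<rfloor> < induced_matching_number E"
            using l1(2) by linarith
          then show "E \<in> {E. k \<le> induced_matching_number E}" by (simp add: k_def)
        qed simp
        also have "\<dots> \<le> (1 / 2) ^ k"
          using p C0[OF m'(2)] k
          by (intro prob_induced_matching_le_explicit[OF \<open>p > 0\<close> _ assms m1]) (auto simp: k_def)
        also have "\<dots> = (1 / 2) powr k" by (simp add: powr_realpow)
        also have "\<dots> \<le> (1 / 2) powr (ln (real n) / 100)"
          using l l1 k by (intro powr_mono') auto
        also have "\<dots> \<le> \<theta>" by (rule elim(1))
        finally show "measure_pmf.prob (gnp n p) {E. (1 + \<epsilon>) * ?l < induced_matching_number E} \<le> \<theta>" .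
      qed
    qed
  qed
qed

text \<open>Rounding down loses at most 1, which
  \<open>1 / \<delta> \<le> log (1 / (1 - p)) (n * p)\<close> absorbs into another
  \<open>\<delta>\<close> fraction. The constant \<open>exp 200\<close> forces
  \<open>ln (n * p) \<ge> 200\<close>, so that \<open>k \<ge> ln (n * p) / (200 * p)\<close> implies
  \<open>1 \<le> k * p\<close>.\<close>

lemma rounded_size_bounds:
  fixes p \<delta> :: real and n :: nat
  assumes p: "0 < p" "p \<le> 0.99" and \<delta>: "0 < \<delta>" "\<delta> \<le> 1 / 4"
    and m: "n * p \<ge> exp 200" and l: "1 / \<delta> \<le> log (1 / (1 - p)) (n * p)"
  defines "k \<equiv> nat \<lfloor>(1 - \<delta>) * log (1 / (1 - p)) (n * p)\<rfloor>"
  shows "k \<ge> 1" "1 \<le> k * p" "k * p \<le> ln (n * p)" "(1 / (1 - p)) powr k \<le> (n * p) powr (1 - \<delta>)"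
    "(1 - 2 * \<delta>) * log (1 / (1 - p)) (n * p) \<le> k" "ln (n * p) / (200 * p) \<le> k"
proof -
  let ?l = "log (1 / (1 - p)) (n * p)"
  have "(1 :: real) < exp 200" by simp
  then have m1: "n * p > 1" using m by linarith
  have L: "ln (n * p) \<ge> 200" using m m1 by (subst ln_ge_iff) auto
  note lb = log_inverse_one_minus_bounds[OF p m1]
  have "4 \<le> 1 / \<delta>" using \<delta> by (simp add: field_simps)
  then have l4: "?l \<ge> 4" using l by linarith
  have \<delta>l: "\<delta> * ?l \<ge> 1" using l \<delta> by (simp add: field_simps)
  have nonneg: "0 \<le> (1 - \<delta>) * ?l" using l4 \<delta> by simp
  then have k: "k \<le> (1 - \<delta>) * ?l" "(1 - \<delta>) * ?l - 1 \<le> k"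
    unfolding k_def by linarith+
  have half: "1 / 2 * ?l \<le> (1 - 2 * \<delta>) * ?l"
    using l4 \<delta> by (intro mult_right_mono) auto
  show k2: "(1 - 2 * \<delta>) * ?l \<le> k"
    using k(2) \<delta>l by (simp add: algebra_simps)
  then have k3: "?l \<le> 2 * real k" using half by linarith
  then show "k \<ge> 1" using l4 by linarith
  show k4: "ln (n * p) / (200 * p) \<le> k"
  proof -
    have "ln (n * p) / (100 * p) \<le> 2 * real k" using lb(1) k3 by linarith
    then show ?thesis using p by (simp add: field_simps)
  qed
  have "200 \<le> 200 * (k * p)"
    using k4 L p by (simp add: field_simps)
  then show "1 \<le> k * p" by linarith
  have "(1 - \<delta>) * ?l \<le> 1 * ?l" using l4 \<delta> by (intro mult_right_mono) auto
  then have "k \<le> ln (n * p) / p" using k(1) lb(2) by linarith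
  then show "k * p \<le> ln (n * p)" using p by (simp add: field_simps)
  have q: "1 / (1 - p) > 1" using p by (simp add: field_simps)
  then have "(1 / (1 - p)) powr k \<le> (1 / (1 - p)) powr (?l * (1 - \<delta>))"
    using k(1) by (intro powr_mono) (auto simp: mult.commute)
  also have "\<dots> = ((1 / (1 - p)) powr ?l) powr (1 - \<delta>)"
    by (simp only: powr_powr)
  also have "(1 / (1 - p)) powr ?l = n * p"
    using q m1 p by (intro powr_log_cancel) auto
  finally show "(1 / (1 - p)) powr k \<le> (n * p) powr (1 - \<delta>)" .
qed

section \<open>Limits of the error terms and the lower tail\<close>

lemma variance_exponent_tendsto_0: "(variance_exponent \<longlongrightarrow> 0) at_top"
  unfolding variance_exponent_def by real_asymp

text \<open>For \<open>n \<le> m powr (5 / 2)\<close>, \<open>4 * k\<^sup>2 / n\<close> is at most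
  \<open>4 * (ln m)\<^sup>2 * m powr (1 / 2)\<close>; \<open>variance_exponent m\<close>, of order
  \<open>ln m * m powr (-3/4)\<close>, outweighs this.\<close>

lemma scaled_variance_exponent_tendsto_0:
  "((\<lambda>m. 4 * (ln m)\<^sup>2 * m powr (1 / 2) * \<bar>variance_exponent m\<bar>) \<longlongrightarrow> 0) at_top"
proof -
  have "((\<lambda>m. 4 * (ln m)\<^sup>2 * m powr (1 / 2) * variance_exponent m) \<longlongrightarrow> 0) at_top"
    unfolding variance_exponent_def by real_asymp
  then have "((\<lambda>m. \<bar>4 * (ln m)\<^sup>2 * m powr (1 / 2) * variance_exponent m\<bar>) \<longlongrightarrow> 0) at_top"
    by (rule tendsto_rabs_zero)
  then show ?thesis by (simp add: abs_mult)
qed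

lemma large_overlap_tendsto_0:
  assumes "\<delta> > 0"
  shows "(large_overlap \<delta> \<longlongrightarrow> 0) at_top"
proof -
  have "((\<lambda>x. 2 * exp 3 * ln x * x powr (- 1 / 8)) \<longlongrightarrow> (0 :: real)) at_top" by real_asymp
  moreover have "((\<lambda>x. 16 * exp 3 * ln x * x powr - \<delta>) \<longlongrightarrow> 0) at_top" using assms by real_asymp
  ultimately show ?thesis
    unfolding large_overlap_def using tendsto_add by fastforce
qed

text \<open>
  In the sparse range the second moment only yields an exponentially small probability of reaching
  \<open>k\<close>, but that probability exceeds McDiarmid's upper tail, so the mean is close to \<open>k\<close>.
\<close>
lemma induced_matching_number_sparse:
  fixes p \<delta> :: real and n k :: nat
  assumes "n \<ge> 1" "k \<ge> 1" "\<delta> > 0"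
    and P: "1 \<le> measure_pmf.prob (gnp n p) {E. k \<le> induced_matching_number E} * (exp (\<delta>\<^sup>2 * k\<^sup>2 / n) + 1)"
    and large: "\<delta>\<^sup>2 * k\<^sup>2 / n \<ge> 1"
  shows "measure_pmf.prob (gnp n p) {E. induced_matching_number E \<le> (1 - 2 * \<delta>) * k} \<le> exp (- 2 * (\<delta>\<^sup>2 * k\<^sup>2 / n))"
proof -
  define X where "X = \<delta>\<^sup>2 * k\<^sup>2 / n"
  define \<mu> where "\<mu> = measure_pmf.expectation (gnp n p) (\<lambda>E. real (induced_matching_number E))"
  let ?P = "measure_pmf.prob (gnp n p)"
  have t: "\<delta> * k > 0" using assms by simp
  have X: "2 * (\<delta> * k)\<^sup>2 / n = 2 * X" by (simp add: X_def power_mult_distrib)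
  \<comment> \<open>Otherwise reaching \<open>k\<close> would be a deviation of at least
    \<open>\<delta> * k\<close> above the mean, of probability at most \<open>exp (- 2 * X)\<close>.
    With the lower bound \<open>1 / (exp X + 1)\<close> this gives
    \<open>1 \<le> 2 * exp (- X)\<close>, impossible for \<open>X \<ge> 1\<close>.\<close>
  have "k < \<mu> + \<delta> * k"
  proof (rule ccontr)
    assume "\<not> k < \<mu> + \<delta> * k"
    then have "?P {E. k \<le> induced_matching_number E} \<le> ?P {E. real (induced_matching_number E) \<ge> \<mu> + \<delta> * k}"
      by (intro measure_pmf.finite_measure_mono) auto
    also have "\<dots> \<le> exp (- 2 * (\<delta> * k)\<^sup>2 / n)"
      unfolding \<mu>_def by (rule induced_matching_number_concentration(1)[OF assms(1) t])
    also have "\<dots> = exp (- 2 * X)" using X by simp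
    finally have "1 \<le> exp (- 2 * X) * (exp X + 1)"
      using P mult_right_mono[of "?P {E. k \<le> induced_matching_number E}" "exp (- 2 * X)" "exp X + 1"]
      by (auto simp: X_def intro: order_trans add_nonneg_nonneg)
    also have "\<dots> \<le> exp (- 2 * X) * (2 * exp X)"
      using large by (intro mult_left_mono) (auto simp: X_def)
    also have "\<dots> = 2 * exp (- X)"
      by (simp add: exp_add[symmetric])
    also have "\<dots> \<le> 2 * exp (- 1)"
      using large by (simp add: X_def)
    also have "\<dots> < 1"
      using exp_gt_one[of 1] exp_lower_Taylor_quadratic[of "1 :: real"] by (simp add: exp_minus field_simps)
    finally show False by simp
  qed
  then have "?P {E. induced_matching_number E \<le> (1 - 2 * \<delta>) * k} \<le>
      ?P {E. real (induced_matching_number E) \<le> \<mu> - \<delta> * k}"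
    by (intro measure_pmf.finite_measure_mono) (auto simp: algebra_simps)
  also have "\<dots> \<le> exp (- 2 * (\<delta> * k)\<^sup>2 / n)"
    unfolding \<mu>_def by (rule induced_matching_number_concentration(2)[OF assms(1) t])
  finally show ?thesis using X by (simp add: X_def)
qed

lemma induced_matching_number_lower_whp:
  fixes \<epsilon> :: real
  assumes "\<epsilon> > 0"
  obtains C where "C > 0" and "\<And>\<theta>. \<theta> > 0 \<Longrightarrow> \<forall>\<^sub>F n in sequentially. \<forall>p::real. C / real n \<le> p \<and> p \<le> 0.99 \<longrightarrow>
    measure_pmf.prob (gnp n p)
      {E. induced_matching_number E < (1 - \<epsilon>) * log (1 / (1 - p)) (n * p)} \<le> \<theta>"
proof -
  \<comment> \<open>Two losses of a factor \<open>1 - 2 * \<delta>\<close>, one in choosing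
    \<open>k\<close> and one from concentration, stay above \<open>1 - \<epsilon>\<close>.\<close>
  define \<delta> where "\<delta> = min \<epsilon> 1 / 4"
  have \<delta>: "0 < \<delta>" "\<delta> \<le> 1 / 4" "4 * \<delta> \<le> \<epsilon>" using assms by (auto simp: \<delta>_def)
  \<comment> \<open>The bound \<open>\<delta>\<^sup>2 / 4\<close> makes the second moment exponent
    at most \<open>\<delta>\<^sup>2 * k\<^sup>2 / n\<close>, half of McDiarmid's exponent.\<close>
  have "\<forall>\<^sub>F m in at_top. \<bar>variance_exponent m\<bar> < \<delta>\<^sup>2 / 4"
    using tendstoD[OF variance_exponent_tendsto_0, of "\<delta>\<^sup>2 / 4"] \<delta> by (simp add: dist_real_def)
  moreover have "\<forall>\<^sub>F m in at_top. \<bar>large_overlap \<delta> m\<bar> < 1 / 4"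
    using tendstoD[OF large_overlap_tendsto_0[OF \<delta>(1)], of "1 / 4"] by (simp add: dist_real_def)
  moreover have "\<forall>\<^sub>F m in at_top. 8 * ln m \<le> (m :: real)" by real_asymp
  ultimately have "\<forall>\<^sub>F m in at_top. \<bar>variance_exponent m\<bar> < \<delta>\<^sup>2 / 4 \<and> \<bar>large_overlap \<delta> m\<bar> < 1 / 4 \<and> 8 * ln m \<le> m"
    by eventually_elim auto
  then obtain C0 where C0: "\<And>m. m \<ge> C0 \<Longrightarrow>
      \<bar>variance_exponent m\<bar> < \<delta>\<^sup>2 / 4 \<and> \<bar>large_overlap \<delta> m\<bar> < 1 / 4 \<and> 8 * ln m \<le> m"
    by (auto simp: eventually_at_top_linorder)
  define C where "C = max C0 (exp 200)"
  define D where "D m = exp (4 * (ln m)\<^sup>2 * m powr (1 / 2) * \<bar>variance_exponent m\<bar>) + 2 * large_overlap \<delta> m" for m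
  have D: "(D \<longlongrightarrow> 1) at_top"
    unfolding D_def
    using tendsto_add[OF tendsto_exp[OF scaled_variance_exponent_tendsto_0] tendsto_mult_left[OF large_overlap_tendsto_0[OF \<delta>(1)], of 2]]
    by simp
  show ?thesis
  proof (rule that[of C])
    show "C > 0" by (simp add: C_def less_max_iff_disj)
    fix \<theta> :: real assume "\<theta> > 0"
    \<comment> \<open>When \<open>n \<le> m powr (5 / 2)\<close>, \<open>D m\<close> bounds the
      second moment ratio, so the success probability times \<open>D m\<close> is at least 1;
      \<open>D m * (1 - \<theta>) < 1\<close> then pushes that probability above
      \<open>1 - \<theta>\<close>.\<close>
    have "((\<lambda>m. D m * (1 - \<theta>)) \<longlongrightarrow> 1 * (1 - \<theta>)) at_top"
      by (intro tendsto_mult D tendsto_const)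
    then have "\<forall>\<^sub>F m in at_top. D m * (1 - \<theta>) < 1"
      by (rule order_tendstoD(2)) (use \<open>\<theta> > 0\<close> in simp)
    then obtain M where M: "\<And>m. m \<ge> M \<Longrightarrow> D m * (1 - \<theta>) < 1"
      by (auto simp: eventually_at_top_linorder)
    have "\<forall>\<^sub>F n in sequentially. M \<le> real n powr (2 / 5)" by real_asymp
    moreover have "\<forall>\<^sub>F n in sequentially. 1 / \<delta> \<le> ln (real n) / 100" by real_asymp
    moreover have "\<forall>\<^sub>F n in sequentially. exp (- 2 * (\<delta>\<^sup>2 * (real n powr (1 / 5) / 40000))) \<le> \<theta>"
      using \<open>\<theta> > 0\<close> \<delta>(1) by real_asymp
    moreover have "\<forall>\<^sub>F n in sequentially. 1 \<le> \<delta>\<^sup>2 * (real n powr (1 / 5) / 40000)"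
      using \<delta>(1) by real_asymp
    moreover have "\<forall>\<^sub>F n in sequentially. n > (0 :: nat)" by (rule eventually_gt_at_top)
    ultimately show "\<forall>\<^sub>F n in sequentially. \<forall>p::real. C / real n \<le> p \<and> p \<le> 0.99 \<longrightarrow>
        measure_pmf.prob (gnp n p)
          {E. induced_matching_number E < (1 - \<epsilon>) * log (1 / (1 - p)) (n * p)} \<le> \<theta>"
    proof eventually_elim
      case (elim n)
      show ?case
      proof (intro allI impI)
        fix p :: real assume p: "C / real n \<le> p \<and> p \<le> 0.99"
        define m where "m = n * p"
        have mC: "m \<ge> C" using p elim(5) by (simp add: m_def field_simps)
        have p0: "p > 0"
          using p \<open>C > 0\<close> elim(5) by (auto intro: less_le_trans[rotated])
        have p': "p \<le> 0.99" "p < 1" using p by auto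
        have m200: "n * p \<ge> exp 200" and mC0: "m \<ge> C0" using mC by (auto simp: C_def m_def)
        have "exp 1 \<le> (exp 200 :: real)" "1 < (exp 200 :: real)" by simp_all
        then have me: "n * p \<ge> exp 1" and m1: "m > 1" using m200 unfolding m_def by linarith+
        have L: "ln m \<ge> 200" using m200 m1 by (simp add: ln_ge_iff m_def)
        let ?l = "log (1 / (1 - p)) (n * p)"
        define k where "k = nat \<lfloor>(1 - \<delta>) * ?l\<rfloor>"
        have l: "1 / \<delta> \<le> ?l" using elim(2) log_ge_ln_card[OF p0 p'(1) me] by linarith
        have l0: "?l \<ge> 0" using l \<delta>(1) by (meson less_eq_real_def order_trans zero_le_divide_1_iff)
        note k = rounded_size_bounds[OF p0 p'(1) \<delta>(1,2) m200 l, folded k_def m_def]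
        have lower: "(1 - \<epsilon>) * ?l \<le> (1 - 2 * \<delta>) * k"
        proof -
          have "1 - \<epsilon> \<le> (1 - 2 * \<delta>) * (1 - 2 * \<delta>)"
          proof -
            have "(1 - 2 * \<delta>) * (1 - 2 * \<delta>) = 1 - 4 * \<delta> + 4 * (\<delta> * \<delta>)" by (simp add: algebra_simps)
            then show ?thesis using \<delta>(3) zero_le_square[of \<delta>] by linarith
          qed
          then have "(1 - \<epsilon>) * ?l \<le> ((1 - 2 * \<delta>) * (1 - 2 * \<delta>)) * ?l"
            using l0 by (rule mult_right_mono)
          also have "\<dots> \<le> (1 - 2 * \<delta>) * k"
            using mult_left_mono[OF k(5), of "1 - 2 * \<delta>"] \<delta> by (simp add: m_def mult.assoc)
          finally show ?thesis .
        qed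
        let ?P = "measure_pmf.prob (gnp n p)"
        note C0' = C0[OF mC0]
        have P: "1 \<le> ?P {E. k \<le> induced_matching_number E} *
            (exp (4 * k\<^sup>2 / n * variance_exponent m) + 2 * large_overlap \<delta> m)"
          unfolding m_def
          by (rule prob_induced_matching_ge_explicit)
            (use p0 p' k \<delta> m1 C0' in \<open>auto simp: m_def\<close>)
        show "?P {E. induced_matching_number E < (1 - \<epsilon>) * ?l} \<le> \<theta>"
        \<comment> \<open>In the first case \<open>m \<ge> n powr (2 / 5)\<close> is large, so
          \<open>D m\<close> is near 1. In the second case \<open>m\<close> may stay bounded, but
          \<open>k\<^sup>2 / n\<close> is large.\<close>
        proof (cases "real n \<le> m powr (5 / 2)")
          case True
          have "real n powr (2 / 5) \<le> (m powr (5 / 2)) powr (2 / 5)"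
            using True by (intro powr_mono2) auto
          also have "\<dots> = m" using m1 by (simp add: powr_powr)
          finally have "m \<ge> M" using elim(1) by linarith
          have "(k * p)\<^sup>2 \<le> (ln m)\<^sup>2"
            using k(3) p0 by (intro power_mono) auto
          then have "4 * k\<^sup>2 / n \<le> 4 * (ln m)\<^sup>2 * (n / m\<^sup>2)"
            using p0 elim(5) by (simp add: m_def field_simps power2_eq_square)
          also have "\<dots> \<le> 4 * (ln m)\<^sup>2 * (m powr (5 / 2) / m\<^sup>2)"
            using True by (intro mult_left_mono divide_right_mono) auto
          also have "m powr (5 / 2) / m\<^sup>2 = m powr (5 / 2) / m powr 2"
            using m1 by simp
          also have "\<dots> = m powr (1 / 2)"
            unfolding powr_diff[symmetric] by simp
          finally have "4 * k\<^sup>2 / n * \<bar>variance_exponent m\<bar> \<le> 4 * (ln m)\<^sup>2 * m powr (1 / 2) * \<bar>variance_exponent m\<bar>"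
            by (intro mult_right_mono) auto
          moreover have "4 * k\<^sup>2 / n * variance_exponent m \<le> 4 * k\<^sup>2 / n * \<bar>variance_exponent m\<bar>"
            by (intro mult_left_mono) auto
          ultimately have "4 * k\<^sup>2 / n * variance_exponent m \<le> 4 * (ln m)\<^sup>2 * m powr (1 / 2) * \<bar>variance_exponent m\<bar>"
            by (rule order_trans[rotated])
          then have "exp (4 * k\<^sup>2 / n * variance_exponent m) + 2 * large_overlap \<delta> m \<le> D m"
            by (simp add: D_def)
          with P have "1 \<le> ?P {E. k \<le> induced_matching_number E} * D m"
            by (rule_tac order_trans[OF P]) (intro mult_left_mono, auto)
          then have *: "(1 - \<theta>) * D m < ?P {E. k \<le> induced_matching_number E} * D m"
            using M[OF \<open>m \<ge> M\<close>] by (simp add: mult.commute)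
          moreover have "D m \<ge> 0"
            using m1 by (simp add: D_def large_overlap_def)
          ultimately have "1 - \<theta> < ?P {E. k \<le> induced_matching_number E}"
            by (rule mult_right_less_imp_less)
          moreover have "?P {E. induced_matching_number E < (1 - \<epsilon>) * ?l} \<le> ?P (UNIV - {E. k \<le> induced_matching_number E})"
          proof (intro measure_pmf.finite_measure_mono subsetI)
            fix E assume "E \<in> {E. induced_matching_number E < (1 - \<epsilon>) * ?l}"
            then have "real (induced_matching_number E) < (1 - 2 * \<delta>) * k" using lower by simp
            also have "\<dots> \<le> 1 * real k" using \<delta> by (intro mult_right_mono) auto
            finally show "E \<in> UNIV - {E. k \<le> induced_matching_number E}" by simp
          qed simp
          moreover have "?P (UNIV - {E. k \<le> induced_matching_number E}) = 1 - ?P {E. k \<le> induced_matching_number E}"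
            using measure_pmf.prob_compl[of "{E. k \<le> induced_matching_number E}" "gnp n p"] by simp
          ultimately show ?thesis by linarith
        next
          case False
          define X where "X = \<delta>\<^sup>2 * k\<^sup>2 / n"
          \<comment> \<open>Since \<open>k \<ge> 1 / (200 * p) = n / (200 * m)\<close>, this yields
            \<open>k\<^sup>2 / n \<ge> n powr (1 / 5) / 40000\<close>, a bound free of
            \<open>p\<close>.\<close>
          have "m\<^sup>2 \<le> real n powr (4 / 5)"
          proof -
            have "(m powr (5 / 2)) powr (4 / 5) \<le> real n powr (4 / 5)"
              using False by (intro powr_mono2) auto
            then show ?thesis using m1 by (simp add: powr_powr)
          qed
          then have "real n / real n powr (4 / 5) \<le> n / m\<^sup>2"
            using m1 elim(5) by (intro divide_left_mono) auto
          moreover have "real n / real n powr (4 / 5) = real n powr (1 - 4 / 5)"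
            using elim(5) by (simp only: powr_diff) simp
          ultimately have "real n powr (1 / 5) / 40000 \<le> n / m\<^sup>2 / 40000" by simp
          also have "\<dots> = (1 / (200 * p))\<^sup>2 / n"
            using elim(5) p0 by (simp add: m_def power2_eq_square field_simps)
          also have "\<dots> \<le> k\<^sup>2 / n"
          proof -
            have "1 / (200 * p) \<le> ln m / (200 * p)"
              using L p0 by (intro divide_right_mono) auto
            then have "1 / (200 * p) \<le> k" using k(6) by linarith
            then have "(1 / (200 * p))\<^sup>2 \<le> (real k)\<^sup>2" using p0 by (intro power_mono) auto
            then show ?thesis by (simp add: divide_right_mono)
          qed
          finally have X: "\<delta>\<^sup>2 * (real n powr (1 / 5) / 40000) \<le> X"
            unfolding X_def times_divide_eq_right[symmetric, of "\<delta>\<^sup>2" "k\<^sup>2"]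
            by (intro mult_left_mono) auto
          have "4 * k\<^sup>2 / n * variance_exponent m \<le> 4 * k\<^sup>2 / n * (\<delta>\<^sup>2 / 4)"
            using C0' by (intro mult_left_mono) auto
          also have "\<dots> = X" by (simp add: X_def)
          finally have "exp (4 * k\<^sup>2 / n * variance_exponent m) + 2 * large_overlap \<delta> m \<le> exp X + 1"
            using C0' by (intro add_mono) auto
          then have P': "1 \<le> ?P {E. k \<le> induced_matching_number E} * (exp X + 1)"
            by (rule_tac order_trans[OF P]) (intro mult_left_mono, auto)
          have "?P {E. induced_matching_number E < (1 - \<epsilon>) * ?l} \<le>
              ?P {E. induced_matching_number E \<le> (1 - 2 * \<delta>) * k}"
            using lower by (intro measure_pmf.finite_measure_mono) auto
          also have "\<dots> \<le> exp (- 2 * X)"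
          proof -
            have "n \<ge> 1" "1 \<le> X" using X elim(4,5) by linarith+
            with P' show ?thesis
              unfolding X_def using k(1) \<delta>(1) by (intro induced_matching_number_sparse)
          qed
          also have "\<dots> \<le> exp (- 2 * (\<delta>\<^sup>2 * (real n powr (1 / 5) / 40000)))"
            using X by simp
          also have "\<dots> \<le> \<theta>" by (rule elim(3))
          finally show ?thesis .
        qed
      qed
    qed
  qed
qed

theorem theorem1p1:
  fixes \<epsilon>\<^sub>0 :: real
  assumes "\<epsilon>\<^sub>0 > 0"
  shows "\<exists>C::real. C > 0 \<and>
    (\<forall>p :: nat \<Rightarrow> real.
       (\<forall>\<^sub>F n in sequentially. C / real n \<le> p n \<and> p n \<le> 0.99) \<longrightarrow>
       (let q = (\<lambda>n. 1 / (1 - p n)) in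
        (\<lambda>n. measure_pmf.prob (gnp n (p n))
           {E. (1 - \<epsilon>\<^sub>0) * log (q n) (real n * p n) \<le> real (induced_matching_number E) \<and>
               real (induced_matching_number E) \<le> (1 + \<epsilon>\<^sub>0) * log (q n) (real n * p n)})
        \<longlonglongrightarrow> 1))"
proof -
  obtain C1 where C1: "C1 > 0" "\<And>\<theta>. \<theta> > 0 \<Longrightarrow> \<forall>\<^sub>F n in sequentially. \<forall>p::real. C1 / real n \<le> p \<and> p \<le> 0.99 \<longrightarrow>
      measure_pmf.prob (gnp n p) {E. (1 + \<epsilon>\<^sub>0) * log (1 / (1 - p)) (n * p) < induced_matching_number E} \<le> \<theta>"
    using induced_matching_number_upper_whp[OF assms] by blast
  obtain C2 where C2: "C2 > 0" "\<And>\<theta>. \<theta> > 0 \<Longrightarrow> \<forall>\<^sub>F n in sequentially. \<forall>p::real. C2 / real n \<le> p \<and> p \<le> 0.99 \<longrightarrow>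
      measure_pmf.prob (gnp n p) {E. induced_matching_number E < (1 - \<epsilon>\<^sub>0) * log (1 / (1 - p)) (n * p)} \<le> \<theta>"
    using induced_matching_number_lower_whp[OF assms] by blast
  define C where "C = max C1 C2"
  show ?thesis
  proof (intro exI[of _ C] conjI allI impI)
    show "C > 0" using C1(1) by (simp add: C_def)
    fix p :: "nat \<Rightarrow> real"
    assume p: "\<forall>\<^sub>F n in sequentially. C / real n \<le> p n \<and> p n \<le> 0.99"
    define A :: "nat \<Rightarrow> nat set set set" where "A n = {E. (1 - \<epsilon>\<^sub>0) * log (1 / (1 - p n)) (real n * p n) \<le> real (induced_matching_number E) \<and>
               real (induced_matching_number E) \<le> (1 + \<epsilon>\<^sub>0) * log (1 / (1 - p n)) (real n * p n)}" for n
    have "(\<lambda>n. measure_pmf.prob (gnp n (p n)) (A n)) \<longlonglongrightarrow> 1"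
    proof (rule tendstoI)
      fix e :: real assume "e > 0"
      \<comment> \<open>Two bad events of probability at most \<open>e / 3\<close> each leave a
        strict inequality.\<close>
      then have "e / 3 > 0" by simp
      from p C1(2)[OF this] C2(2)[OF this]
      show "\<forall>\<^sub>F n in sequentially. dist (measure_pmf.prob (gnp n (p n)) (A n)) 1 < e"
      proof eventually_elim
        case (elim n)
        let ?P = "measure_pmf.prob (gnp n (p n))"
        let ?U = "{E. (1 + \<epsilon>\<^sub>0) * log (1 / (1 - p n)) (n * p n) < induced_matching_number E}"
        let ?L = "{E. induced_matching_number E < (1 - \<epsilon>\<^sub>0) * log (1 / (1 - p n)) (n * p n)}"
        have "C1 / real n \<le> C / real n" "C2 / real n \<le> C / real n"
          by (simp_all add: C_def divide_right_mono)
        then have "C1 / real n \<le> p n \<and> p n \<le> 0.99" "C2 / real n \<le> p n \<and> p n \<le> 0.99"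
          using elim(1) by auto
        then have UL: "?P ?U \<le> e / 3" "?P ?L \<le> e / 3"
          using elim(2,3) by blast+
        have "1 - ?P (A n) = ?P (UNIV - A n)"
          using measure_pmf.prob_compl[of "A n" "gnp n (p n)"] by simp
        also have "\<dots> \<le> ?P (?U \<union> ?L)"
          by (intro measure_pmf.finite_measure_mono) (auto simp: A_def)
        also have "\<dots> \<le> ?P ?U + ?P ?L"
          by (intro measure_Un_le) auto
        finally have "1 - ?P (A n) < e" using UL \<open>e > 0\<close> by linarith
        moreover have "?P (A n) \<le> 1" by simp
        ultimately show ?case by (simp add: dist_real_def)
      qed
    qed
    then show "let q = (\<lambda>n. 1 / (1 - p n)) in
        (\<lambda>n. measure_pmf.prob (gnp n (p n))
           {E. (1 - \<epsilon>\<^sub>0) * log (q n) (real n * p n) \<le> real (induced_matching_number E) \<and>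
               real (induced_matching_number E) \<le> (1 + \<epsilon>\<^sub>0) * log (q n) (real n * p n)})
        \<longlonglongrightarrow> 1"
      by (simp add: A_def Let_def)
  qed
qed

end
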